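(* Let $n\ge2$ be an integer, $1<p<n$, let $Q\ge 1$ be an integer and $\beta>1$ a real number. Let $u\in C^2(B(0,1)\setminus\{0\})$ be a positive function, such that $\log_1 u,\dots,\log_Q u$ are defined and positive on $B(0,1)\setminus\{0\}$, satisfying $$0\le -\Delta_p u\le \frac{u^{\frac{n(p-1)}{n-p}}}{\log_1 u\cdot\log_2 u\cdots\log_{Q-1}u\cdot(\log_Q u)^{\beta}}\quad\text{in } B(0,1)\setminus\{0\}.$$ Then the following does NOT occur: $$\lim_{x\to 0}|x|^{\frac{n-p}{p-1}}u(x)=0\quad\text{and}\quad \liminf_{x\to 0}\Big(\log\frac{1}{|x|}\Big)^{\frac{n-p}{p(p-1)}}|x|^{\frac{n-p}{p-1}}u(x)\ \ge\ \left(\Big(\frac{n-p}{p}\Big)\Big(\frac{n-p}{p-1}\Big)^{p-1}\right)^{\frac{n-p}{p(p-1)}}.$$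
   Context: $B(0,1)=\{x\in\mathbb{R}^n:|x|<1\}$. The $p$-Laplacian is $\Delta_p u=\operatorname{div}(|\nabla u|^{p-2}\nabla u)$; differential inequalities involving $\Delta_p$ are understood in the weak (distributional) sense, which agrees with the pointwise sense wherever the latter makes sense. $\log_Q u=\log\log\cdots\log u$ denotes the $Q$-fold iterated logarithm ($\log_1=\log$); for $Q=1$ the denominator is $(\log u)^\beta$. *)

theory Defs
  imports "HOL-Analysis.Analysis"
begin

(* C^k regularity of a real-valued function on an open set S. Differentiability at every
   point together with continuity of the partial derivatives is the usual C^1; as S is
   open, the values of f outside S are irrelevant. *)
primrec Ck_on :: "nat \<Rightarrow> ('a::euclidean_space \<Rightarrow> real) \<Rightarrow> 'a set \<Rightarrow> bool" where
  "Ck_on 0 f S \<longleftrightarrow> continuous_on S f"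
| "Ck_on (Suc k) f S \<longleftrightarrow>
     (\<forall>x\<in>S. f differentiable (at x)) \<and>
     (\<forall>b\<in>Basis. Ck_on k (\<lambda>x. frechet_derivative f (at x) b) S)"

definition grad :: "('a::euclidean_space \<Rightarrow> real) \<Rightarrow> 'a \<Rightarrow> 'a" where
  "grad f x = (THE D. GDERIV f x :> D)"

(* Nonnegative functions in C_c^\<infinity>(\<Omega>), extended by 0 to the whole space. *)
definition nonneg_test_function :: "('a::euclidean_space) set \<Rightarrow> ('a \<Rightarrow> real) \<Rightarrow> bool" where
  "nonneg_test_function \<Omega> \<phi> \<longleftrightarrow>
     (\<forall>k. Ck_on k \<phi> UNIV) \<and>
     compact (closure {x. \<phi> x \<noteq> 0}) \<and> closure {x. \<phi> x \<noteq> 0} \<subseteq> \<Omega> \<and>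
     (\<forall>x. \<phi> x \<ge> 0)"

(* The vector field |grad u|^(p-2) grad u. It is 0 wherever grad u = 0, for every p,
   which is its continuous extension when 1 < p < 2. *)
definition p_flux :: "real \<Rightarrow> ('a::euclidean_space \<Rightarrow> real) \<Rightarrow> 'a \<Rightarrow> 'a" where
  "p_flux p u x = (norm (grad u x) powr (p - 2)) *\<^sub>R grad u x"

(* The distribution -Delta_p u = -div(|grad u|^(p-2) grad u) applied to a test function. *)
definition neg_p_Laplacian ::
  "real \<Rightarrow> ('a::euclidean_space) set \<Rightarrow> ('a \<Rightarrow> real) \<Rightarrow> ('a \<Rightarrow> real) \<Rightarrow> real" where
  "neg_p_Laplacian p \<Omega> u \<phi> = (LINT x:\<Omega>|lborel. p_flux p u x \<bullet> grad \<phi> x)"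

(* f \<le> -Delta_p u and -Delta_p u \<le> f in \<Omega>, in the weak sense. Meant for u in C^1(\<Omega>),
   p > 1 and f continuous on \<Omega>, where all integrands are continuous with compact support
   in \<Omega> and hence integrable. *)
definition neg_p_Laplacian_ge ::
  "real \<Rightarrow> ('a::euclidean_space) set \<Rightarrow> ('a \<Rightarrow> real) \<Rightarrow> ('a \<Rightarrow> real) \<Rightarrow> bool" where
  "neg_p_Laplacian_ge p \<Omega> u f \<longleftrightarrow>
     (\<forall>\<phi>. nonneg_test_function \<Omega> \<phi> \<longrightarrow>
        (LINT x:\<Omega>|lborel. f x * \<phi> x) \<le> neg_p_Laplacian p \<Omega> u \<phi>)"

definition neg_p_Laplacian_le ::
  "real \<Rightarrow> ('a::euclidean_space) set \<Rightarrow> ('a \<Rightarrow> real) \<Rightarrow> ('a \<Rightarrow> real) \<Rightarrow> bool" where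
  "neg_p_Laplacian_le p \<Omega> u f \<longleftrightarrow>
     (\<forall>\<phi>. nonneg_test_function \<Omega> \<phi> \<longrightarrow>
        neg_p_Laplacian p \<Omega> u \<phi> \<le> (LINT x:\<Omega>|lborel. f x * \<phi> x))"

(* The real ln is even in this library (ln (-x) = ln x), so the analytic iterated
   logarithm is only meant when y and all lower iterates are positive. *)
definition iter_log :: "nat \<Rightarrow> real \<Rightarrow> real" where
  "iter_log Q y = (ln ^^ Q) y"

end

(* With alpha = (n - p)/(p - 1), the liminf hypothesis gives u >= |x|^(-alpha/2) near 0, so the
   logarithms of u dominate those of |x|^(-alpha/2) and -Delta_p u <= C u^(n/alpha) m(|x|), where
   m(r) dr/r is integrable at 0 because beta > 1.  A function V of r = |x| with
   V' = -r^(-alpha-1) G satisfies -Delta_p V = (p-1) r^(1-n) G^(p-2) G'.  If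
   u <= eta r^(-alpha) (eps + (r/R)^(alpha/2)) for r <= R, with eta small, the choice
     G = (alpha/4) eta (eps (1/2 + int_0^r m ds/s) + (r/R)^(alpha/2))
   makes V a strict supersolution for the right-hand side evaluated at this bound, and V > u near 0
   since u = o(r^(-alpha)).  The maximum principle gives u <= V, which improves eps to eps/2.
   Iterating, u = O(r^(-alpha/2)), whereas the liminf hypothesis forces r^(alpha/2) u to tend to
   infinity.  As V has no critical point, the maximum principle is needed only where grad u is
   nonzero; there the weak inequality is a pointwise one. *)

theory Submission
  imports Defs "HOL-Real_Asymp.Real_Asymp"
begin

subsection \<open>Test functions and integration by parts\<close>

text \<open>The power r^(-\<alpha>) is the fundamental solution of the p-Laplacian, so a constant G
  makes V p-harmonic and only G' is left to balance the nonlinearity. The exponent q = n/\<alpha> is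
  critical: inserting r^(-\<alpha>) into u^q gives r^(-n), the scaling of r^(1-n) G' with r G' of
  order m, and the Dini integrability of m is what keeps G bounded. The gain of a factor 2 comes
  from q > p - 1: the size \<eta> E of the assumed bound enters the right-hand side to the power q
  but the barrier to the power p - 1. For small \<eta> a quarter of the natural flux \<alpha> \<eta>
  E therefore suffices. Integrating it turns \<alpha>/4 into the coefficients \<epsilon>/4 and 1/2
  of the two powers of r, which leaves room for the boundary value on the outer sphere. The term
  (r/R)^(\<alpha>/2) is multiplied by \<alpha>/2 under r d/dr, so it absorbs m as soon as m \<le>
  \<alpha>/2 and needs no integral of m. Since \<eta> and R do not depend on \<epsilon>, the halving
  can be repeated on one fixed ball.\<close>

definition flat_exp :: "nat \<Rightarrow> real \<Rightarrow> real" where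
  "flat_exp k t = (if t > 0 then (1 / t) ^ k * exp (- (1 / t)) else 0)"

lemma flat_exp_pos_iff: "flat_exp k t > 0 \<longleftrightarrow> t > 0"
  by (auto simp: flat_exp_def)

lemma flat_exp_nonneg: "flat_exp k t \<ge> 0"
  by (auto simp: flat_exp_def)

lemma flat_exp_tendsto_0: "(flat_exp k \<longlongrightarrow> 0) (at 0)"
proof (rule filterlim_split_at)
  show "(flat_exp k \<longlongrightarrow> 0) (at_left 0)"
    by (rule tendsto_eventually) (auto simp: flat_exp_def eventually_at_filter)
  have "((\<lambda>t::real. (inverse t) ^ k / exp (inverse t)) \<longlongrightarrow> 0) (at_right 0)"
    by (rule filterlim_compose[OF tendsto_power_div_exp_0 filterlim_inverse_at_top_right])
  then show "(flat_exp k \<longlongrightarrow> 0) (at_right 0)"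
    by (rule Lim_transform_eventually)
      (auto simp: flat_exp_def eventually_at_filter exp_minus field_simps)
qed

text \<open>With s = 1/t each member is s^k exp(-s) and ds/dt = -s^2, so the family is closed under
  differentiation up to linear combinations. At t = 0 the difference quotient is the next member
  \<open>flat_exp (Suc k)\<close>, which tends to 0 there.\<close>

lemma flat_exp_DERIV:
  "(flat_exp k has_real_derivative flat_exp (k + 2) t - real k * flat_exp (k + 1) t) (at t)"
proof -
  consider "t > 0" | "t < 0" | "t = 0" by linarith
  then show ?thesis
  proof cases
    case 1
    have s: "((\<lambda>t. 1 / t) has_real_derivative - ((1 / t)\<^sup>2)) (at t)"
      using 1 by (auto intro!: derivative_eq_intros simp: power2_eq_square)
    have "((\<lambda>s. s ^ k * exp (- s)) has_real_derivative
        real k * s ^ (k - 1) * exp (- s) - s ^ k * exp (- s)) (at s)" for s :: real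
      by (auto intro!: derivative_eq_intros)
    from DERIV_chain2[OF this s]
    have "((\<lambda>t. (1 / t) ^ k * exp (- (1 / t))) has_real_derivative
        (real k * (1 / t) ^ (k - 1) * exp (- (1 / t)) - (1 / t) ^ k * exp (- (1 / t)))
          * - ((1 / t)\<^sup>2)) (at t)" .
    also have "(real k * (1 / t) ^ (k - 1) * exp (- (1 / t)) - (1 / t) ^ k * exp (- (1 / t)))
          * - ((1 / t)\<^sup>2) = flat_exp (k + 2) t - real k * flat_exp (k + 1) t"
      using 1 by (cases k) (auto simp: flat_exp_def power2_eq_square algebra_simps add_divide_distrib simp del: power_one_over)
    finally have "((\<lambda>t. (1 / t) ^ k * exp (- (1 / t))) has_real_derivative
        flat_exp (k + 2) t - real k * flat_exp (k + 1) t) (at t)" .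
    then show ?thesis
      by (rule has_field_derivative_transform_within_open[of _ _ _ "{0<..}"])
        (use 1 in \<open>auto simp: flat_exp_def\<close>)
  next
    case 2
    have "((\<lambda>t. 0) has_real_derivative flat_exp (k + 2) t - real k * flat_exp (k + 1) t) (at t)"
      using 2 by (auto simp: flat_exp_def)
    then show ?thesis
      by (rule has_field_derivative_transform_within_open[of _ _ _ "{..<0}"])
        (use 2 in \<open>auto simp: flat_exp_def\<close>)
  next
    case 3
    have "((\<lambda>h. flat_exp k h / h) \<longlongrightarrow> 0) (at 0)"
      using flat_exp_tendsto_0[of "Suc k"]
      by (rule Lim_transform_eventually) (auto simp: flat_exp_def eventually_at_filter)
    then show ?thesis
      using 3 by (auto simp: DERIV_def flat_exp_def)
  qed
qed

text \<open>An algebra large enough to contain all iterated partial derivatives of the bump. Its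
  closure under partial derivatives yields \<open>Ck_on k\<close> for every k by one induction, with
  no formula for higher derivatives; k is free in \<open>flat\<close> because differentiation raises
  it.\<close>

inductive bump_algebra :: "'a::euclidean_space \<Rightarrow> real \<Rightarrow> ('a \<Rightarrow> real) \<Rightarrow> bool" for x0 c where
  flat: "bump_algebra x0 c (\<lambda>x. flat_exp k (c - (x - x0) \<bullet> (x - x0)))"
| const: "bump_algebra x0 c (\<lambda>x. a)"
| inner: "bump_algebra x0 c (\<lambda>x. (x - x0) \<bullet> b)"
| add: "bump_algebra x0 c f \<Longrightarrow> bump_algebra x0 c g \<Longrightarrow> bump_algebra x0 c (\<lambda>x. f x + g x)"
| mult: "bump_algebra x0 c f \<Longrightarrow> bump_algebra x0 c g \<Longrightarrow> bump_algebra x0 c (\<lambda>x. f x * g x)"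

lemma bump_algebra_derivative:
  assumes "bump_algebra x0 c f"
  shows "\<exists>D. (\<forall>x. (f has_derivative D x) (at x)) \<and> (\<forall>b. bump_algebra x0 c (\<lambda>x. D x b))"
  using assms
proof induction
  case (flat k)
  let ?t = "\<lambda>x. c - (x - x0) \<bullet> (x - x0)"
  let ?D = "\<lambda>x h. (flat_exp (k + 2) (?t x) + - real k * flat_exp (k + 1) (?t x)) * (- 2 * ((x - x0) \<bullet> h))"
  have "((\<lambda>x. flat_exp k (?t x)) has_derivative ?D x) (at x)" for x
  proof -
    have t: "(?t has_derivative (\<lambda>h. - 2 * ((x - x0) \<bullet> h))) (at x)"
      by (auto intro!: derivative_eq_intros simp: inner_commute)
    show ?thesis
      using has_derivative_compose[OF t flat_exp_DERIV[of k "?t x", unfolded has_field_derivative_def]]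
      by (simp add: algebra_simps)
  qed
  moreover have "bump_algebra x0 c (\<lambda>x. ?D x b)" for b
    by (intro bump_algebra.intros)
  ultimately show ?case by (intro exI[of _ ?D] conjI allI)
next
  case (const a)
  show ?case by (rule exI[of _ "\<lambda>x h. 0"]) (auto intro: bump_algebra.const)
next
  case (inner b)
  show ?case
    by (rule exI[of _ "\<lambda>x h. h \<bullet> b"])
      (auto intro!: bump_algebra.const derivative_eq_intros)
next
  case (add f g)
  then obtain D E where "\<forall>x. (f has_derivative D x) (at x)" "\<forall>b. bump_algebra x0 c (\<lambda>x. D x b)"
    "\<forall>x. (g has_derivative E x) (at x)" "\<forall>b. bump_algebra x0 c (\<lambda>x. E x b)"
    by blast
  then show ?case
    by (intro exI[of _ "\<lambda>x h. D x h + E x h"])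
      (auto intro!: bump_algebra.add has_derivative_add)
next
  case (mult f g)
  then obtain D E where "\<forall>x. (f has_derivative D x) (at x)" "\<forall>b. bump_algebra x0 c (\<lambda>x. D x b)"
    "\<forall>x. (g has_derivative E x) (at x)" "\<forall>b. bump_algebra x0 c (\<lambda>x. E x b)"
    by blast
  then show ?case
    using mult.hyps
    by (intro exI[of _ "\<lambda>x h. f x * E x h + D x h * g x"])
      (auto intro!: bump_algebra.add bump_algebra.mult has_derivative_mult)
qed

lemma bump_algebra_Ck_on: "bump_algebra x0 c f \<Longrightarrow> Ck_on k f UNIV"
proof (induction k arbitrary: f)
  case 0
  then obtain D where "\<forall>x. (f has_derivative D x) (at x)"
    using bump_algebra_derivative by blast
  then show ?case
    by (auto intro!: continuous_at_imp_continuous_on has_derivative_continuous)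
next
  case (Suc k)
  then obtain D where D: "\<And>x. (f has_derivative D x) (at x)" "\<And>b. bump_algebra x0 c (\<lambda>x. D x b)"
    using bump_algebra_derivative by blast
  have "frechet_derivative f (at x) = D x" for x
    using frechet_derivative_at[OF D(1)] by simp
  with D Suc.IH show ?case
    by (auto simp: differentiable_def)
qed

lemma bump_function_exists:
  fixes x0 :: "'a::euclidean_space"
  assumes "\<rho> > 0"
  obtains \<phi> where "\<And>k. Ck_on k \<phi> UNIV" "\<And>x. \<phi> x \<ge> (0::real)" "\<And>x. \<phi> x \<noteq> 0 \<longleftrightarrow> x \<in> ball x0 \<rho>"
proof
  let ?\<phi> = "\<lambda>x. flat_exp 0 (\<rho>\<^sup>2 - (x - x0) \<bullet> (x - x0))"
  show "Ck_on k ?\<phi> UNIV" for k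
    by (rule bump_algebra_Ck_on[OF bump_algebra.flat])
  show "?\<phi> x \<ge> 0" for x by (rule flat_exp_nonneg)
  have "?\<phi> x \<noteq> 0 \<longleftrightarrow> (norm (x - x0))\<^sup>2 < \<rho>\<^sup>2" for x
    using flat_exp_nonneg flat_exp_pos_iff by (metis diff_gt_0_iff_gt dot_square_norm order_less_le)
  then show "?\<phi> x \<noteq> 0 \<longleftrightarrow> x \<in> ball x0 \<rho>" for x
    using assms by (auto simp: dist_norm norm_minus_commute dest: power_less_imp_less_base intro: power_strict_mono)
qed

text \<open>Translation invariance of Lebesgue measure makes the integral of every difference
  quotient in direction b vanish. The mean value theorem bounds the quotients by B, and dominated
  convergence passes to the derivative. Summed over the basis, this is the divergence theorem for
  compactly supported fields.\<close>

lemma integral_directional_derivative_eq_0: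
  fixes F :: "'a::euclidean_space \<Rightarrow> real"
  assumes F: "\<And>x. (F has_derivative F' x) (at x)"
    and supp: "\<And>x. norm x > r \<Longrightarrow> F x = 0"
    and B: "\<And>x. \<bar>F' x b\<bar> \<le> B"
  shows "integrable lborel (\<lambda>x. F' x b)" "(LINT x|lborel. F' x b) = 0"
proof -
  have contF: "continuous_on UNIV F"
    using F by (auto intro!: continuous_at_imp_continuous_on has_derivative_continuous)
  then have mF[measurable]: "F \<in> borel_measurable borel"
    by (rule borel_measurable_continuous_onI)
  define s where "s i x = (F (x + (1 / real (Suc i)) *\<^sub>R b) - F x) * real (Suc i)" for i x
  have ms[measurable]: "s i \<in> borel_measurable borel" for i
    unfolding s_def by measurable
  have lim: "(\<lambda>i. s i x) \<longlonglongrightarrow> F' x b" for x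
  proof -
    have line: "((\<lambda>t. x + t *\<^sub>R b) has_derivative (\<lambda>t. t *\<^sub>R b)) (at 0)"
      by (auto intro!: derivative_eq_intros)
    have "((\<lambda>t. F (x + t *\<^sub>R b)) has_derivative (\<lambda>t. F' x (t *\<^sub>R b))) (at (0::real))"
      using has_derivative_compose[OF line, of F "F' x"] F by simp
    moreover have "linear (F' x)" using F by (meson has_derivative_linear)
    ultimately have "((\<lambda>t. F (x + t *\<^sub>R b)) has_real_derivative F' x b) (at 0)"
      by (simp add: has_field_derivative_def linear_cmul mult_commute_abs)
    then have "((\<lambda>h. (F (x + h *\<^sub>R b) - F x) / h) \<longlongrightarrow> F' x b) (at 0)"
      by (simp add: DERIV_def)
    moreover have "filterlim (\<lambda>i. 1 / real (Suc i)) (at 0) sequentially"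
      using LIMSEQ_inverse_real_of_nat
      by (auto simp: filterlim_at inverse_eq_divide)
    ultimately have "(\<lambda>i. (F (x + (1 / real (Suc i)) *\<^sub>R b) - F x) / (1 / real (Suc i))) \<longlonglongrightarrow> F' x b"
      by (rule filterlim_compose)
    then show ?thesis by (simp add: s_def)
  qed
  have m': "(\<lambda>x. F' x b) \<in> borel_measurable borel"
    by (rule borel_measurable_LIMSEQ_real[OF lim]) simp
  \<comment> \<open>The steps 1/(i+1) are at most 1, so every quotient vanishes beyond radius r +
    |b| and one function dominates the whole sequence.\<close>
  have bound: "\<bar>s i x\<bar> \<le> indicator (cball 0 (r + norm b)) x * B" for i x
  proof (cases "norm x \<le> r + norm b")
    case False
    have n: "norm (x + (1 / real (Suc i)) *\<^sub>R b) \<ge> norm x - norm b"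
    proof -
      have "norm ((1 / real (Suc i)) *\<^sub>R b) \<le> norm b"
        by (simp add: divide_le_eq mult_le_cancel_left1 algebra_simps)
      then show ?thesis
        using norm_diff_ineq[of x "(1 / real (Suc i)) *\<^sub>R b"] by linarith
    qed
    have "F (x + (1 / real (Suc i)) *\<^sub>R b) = 0" "F x = 0"
      using False n norm_ge_zero[of b] by (auto intro!: supp simp del: norm_ge_zero)
    then have "s i x = 0" by (simp only: s_def) simp
    then show ?thesis using False by simp
  next
    case True
    have d: "((\<lambda>t. F (x + t *\<^sub>R b)) has_real_derivative F' (x + t *\<^sub>R b) b) (at t)" for t :: real
    proof -
      have line: "((\<lambda>t. x + t *\<^sub>R b) has_derivative (\<lambda>t. t *\<^sub>R b)) (at t)"
        by (auto intro!: derivative_eq_intros)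
      have "((\<lambda>t. F (x + t *\<^sub>R b)) has_derivative (\<lambda>s. F' (x + t *\<^sub>R b) (s *\<^sub>R b))) (at t)"
        using has_derivative_compose[OF line F] by simp
      moreover have "linear (F' (x + t *\<^sub>R b))" using F by (meson has_derivative_linear)
      ultimately show ?thesis
        by (simp add: has_field_derivative_def linear_cmul mult_commute_abs)
    qed
    obtain z where "F (x + (1 / real (Suc i)) *\<^sub>R b) - F (x + 0 *\<^sub>R b) = (1 / real (Suc i) - 0) * F' (x + z *\<^sub>R b) b"
      using MVT2[of 0 "1 / real (Suc i)", OF _ d] by auto
    then have "s i x = F' (x + z *\<^sub>R b) b" by (simp add: s_def)
    then show ?thesis using B True by simp
  qed
  have ic: "integrable lborel (\<lambda>x. indicator (cball (0::'a) (r + norm b)) x * B)"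
    using borel_integrable_compact[of "cball (0::'a) (r + norm b)" "\<lambda>x. B"] by simp
  have iF: "integrable lborel F"
  proof -
    have "integrable lborel (\<lambda>x. indicator (cball 0 r) x *\<^sub>R F x)"
      by (rule borel_integrable_compact) (auto intro: continuous_on_subset[OF contF])
    moreover have "indicator (cball 0 r) x *\<^sub>R F x = F x" for x
      using supp[of x] by (auto simp: indicator_def)
    ultimately show ?thesis by (simp only:)
  qed
  have tr: "integrable lborel (\<lambda>x. F (x + c)) \<and> (LINT x|lborel. F (x + c)) = (LINT x|lborel. F x)" for c
  proof -
    have "integrable (distr lborel borel ((+) c)) F" using iF by (simp add: lborel_distr_plus)
    then have 1: "integrable lborel (\<lambda>x. F (c + x))" by (subst (asm) integrable_distr_eq) auto
    have "(LINT x|distr lborel borel ((+) c). F x) = (LINT x|lborel. F (c + x))"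
      by (subst integral_distr) auto
    then have "(LINT x|lborel. F (c + x)) = (LINT x|lborel. F x)" by (simp only: lborel_distr_plus)
    with 1 show ?thesis by (simp add: add.commute)
  qed
  have zero: "(LINT x|lborel. s i x) = 0" for i
    unfolding s_def using iF tr by simp
  have dom: "AE x in lborel. norm (s i x) \<le> indicator (cball 0 (r + norm b)) x * B" for i
    using bound by simp
  have l: "AE x in lborel. (\<lambda>i. s i x) \<longlonglongrightarrow> F' x b" using lim by simp
  show "integrable lborel (\<lambda>x. F' x b)"
    by (rule integrable_dominated_convergence[OF _ _ ic l dom]) (use m' in auto)
  have "(\<lambda>i. LINT x|lborel. s i x) \<longlonglongrightarrow> (LINT x|lborel. F' x b)"
    by (rule integral_dominated_convergence[OF _ _ ic l dom]) (use m' in auto)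
  then show "(LINT x|lborel. F' x b) = 0"
    by (simp add: zero LIMSEQ_const_iff)
qed

subsection \<open>From weak to pointwise inequalities\<close>

lemma grad_eqI: "(f has_derivative (\<lambda>h. D \<bullet> h)) (at x) \<Longrightarrow> grad f x = D"
  unfolding grad_def
proof (rule the_equality)
  assume D: "(f has_derivative (\<lambda>h. D \<bullet> h)) (at x)"
  then show "GDERIV f x :> D"
    by (simp add: gderiv_def inner_commute)
  fix E assume "GDERIV f x :> E"
  then have "(\<lambda>h. h \<bullet> E) = (\<lambda>h. D \<bullet> h)"
    using D has_derivative_unique unfolding gderiv_def by blast
  then have "(E - D) \<bullet> (E - D) = 0"
    by (metis inner_commute inner_diff_right right_minus_eq)
  then show "E = D" by simp
qed

lemma linear_basis_expansion:
  fixes A :: "'a::euclidean_space \<Rightarrow> 'b::real_vector"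
  assumes "linear A"
  shows "A h = (\<Sum>b\<in>Basis. (h \<bullet> b) *\<^sub>R A b)"
  by (subst euclidean_representation[of h, symmetric])
    (simp only: linear_sum[OF assms] linear_cmul[OF assms])

text \<open>Continuity of the Hessian D is expressed by applying it to continuous fields w. Constant
  w gives the trace and w = g gives the quadratic form along the gradient, the two ways in which D
  enters the p-Laplacian.\<close>

lemma Ck_on_2_gradient_field:
  fixes u :: "'a::euclidean_space \<Rightarrow> real"
  assumes "Ck_on 2 u S"
  obtains g D where "\<And>x. x \<in> S \<Longrightarrow> (u has_derivative (\<lambda>h. g x \<bullet> h)) (at x)"
    "\<And>x. x \<in> S \<Longrightarrow> (g has_derivative D x) (at x)"
    "\<And>w. continuous_on S w \<Longrightarrow> continuous_on S (\<lambda>x. D x (w x))"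
proof
  let ?p = "\<lambda>b x. frechet_derivative u (at x) b"
  let ?q = "\<lambda>b x. frechet_derivative (?p b) (at x)"
  let ?g = "\<lambda>x. \<Sum>b\<in>Basis. ?p b x *\<^sub>R b"
  let ?D = "\<lambda>x h. \<Sum>b\<in>Basis. ?q b x h *\<^sub>R b"
  have u: "u differentiable (at x)" "\<And>b. b \<in> Basis \<Longrightarrow> ?p b differentiable (at x)" if "x \<in> S" for x
    using assms that by (auto simp: numeral_2_eq_2)
  have c: "continuous_on S (\<lambda>x. ?q b x c)" if "b \<in> Basis" "c \<in> Basis" for b c
    using assms that by (auto simp: numeral_2_eq_2)
  show "(u has_derivative (\<lambda>h. ?g x \<bullet> h)) (at x)" if "x \<in> S" for x
  proof -
    have d: "(u has_derivative frechet_derivative u (at x)) (at x)"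
      using u(1)[OF that] frechet_derivative_works by blast
    have "?g x \<bullet> h = frechet_derivative u (at x) h" for h
      by (subst linear_basis_expansion[OF has_derivative_linear[OF d], of h])
        (simp add: inner_sum_left inner_commute[of h] mult.commute)
    with d show ?thesis by simp
  qed
  have q: "(?p b has_derivative ?q b x) (at x)" if "x \<in> S" "b \<in> Basis" for x b
    using u(2)[OF that] frechet_derivative_works by blast
  show "(?g has_derivative ?D x) (at x)" if "x \<in> S" for x
    by (auto intro!: has_derivative_sum has_derivative_scaleR_left q that)
  show "continuous_on S (\<lambda>x. ?D x (w x))" if "continuous_on S w" for w
  proof -
    have "continuous_on S (\<lambda>x. \<Sum>b\<in>Basis. (\<Sum>c\<in>Basis. (w x \<bullet> c) *\<^sub>R ?q b x c) *\<^sub>R b)"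
      by (intro continuous_intros c that)
    then show ?thesis
      by (rule continuous_on_eq)
        (auto intro!: sum.cong simp: linear_basis_expansion[OF has_derivative_linear[OF q], symmetric, unfolded real_scaleR_def])
  qed
qed

text \<open>The nondivergence form of the p-Laplacian at a point with gradient \<xi> \<noteq> 0 and
  Hessian A, obtained by expanding div(|\<xi>|^(p-2) \<xi>). It depends on these two data alone,
  hence can be compared at a touching point.\<close>

definition pointwise_p_Laplacian :: "real \<Rightarrow> 'a::euclidean_space \<Rightarrow> ('a \<Rightarrow> 'a) \<Rightarrow> real" where
  "pointwise_p_Laplacian p \<xi> A =
     norm \<xi> powr (p - 2) * ((\<Sum>b\<in>Basis. A b \<bullet> b) + (p - 2) * (\<xi> \<bullet> A \<xi>) / (norm \<xi>)\<^sup>2)"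

lemma flux_has_derivative:
  fixes g :: "'a::euclidean_space \<Rightarrow> 'a"
  assumes g: "(g has_derivative A) (at x)" and nz: "g x \<noteq> 0"
  shows "((\<lambda>y. norm (g y) powr (p - 2) *\<^sub>R g y) has_derivative
    (\<lambda>h. norm (g x) powr (p - 2) *\<^sub>R A h
       + ((p - 2) * norm (g x) powr (p - 2) * (g x \<bullet> A h) / (norm (g x))\<^sup>2) *\<^sub>R g x)) (at x)"
proof -
  have n: "norm (g y) powr (p - 2) = (g y \<bullet> g y) powr ((p - 2) / 2)" for y
    by (simp add: norm_eq_sqrt_inner powr_half_sqrt[symmetric] powr_powr)
  have i: "((\<lambda>y. g y \<bullet> g y) has_derivative (\<lambda>h. 2 * (g x \<bullet> A h))) (at x)"
    using has_derivative_inner[OF g g] by (simp add: inner_commute)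
  have pos: "g x \<bullet> g x > 0" using nz by simp
  have "((\<lambda>t. t powr ((p - 2) / 2)) has_derivative
      (*) ((p - 2) / 2 * (g x \<bullet> g x) powr ((p - 2) / 2 - 1))) (at (g x \<bullet> g x))"
    using has_real_derivative_powr[OF pos, of "(p - 2) / 2"] unfolding has_field_derivative_def .
  from has_derivative_compose[OF i this]
  have "((\<lambda>y. (g y \<bullet> g y) powr ((p - 2) / 2)) has_derivative
      (\<lambda>h. (p - 2) / 2 * (g x \<bullet> g x) powr ((p - 2) / 2 - 1) * (2 * (g x \<bullet> A h)))) (at x)" .
  moreover have "(p - 2) / 2 * (g x \<bullet> g x) powr ((p - 2) / 2 - 1) * (2 * (g x \<bullet> A h)) =
      (p - 2) * norm (g x) powr (p - 2) * (g x \<bullet> A h) / (norm (g x))\<^sup>2" for h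
    using pos unfolding n by (simp add: powr_diff dot_square_norm)
  ultimately have "((\<lambda>y. norm (g y) powr (p - 2)) has_derivative
      (\<lambda>h. (p - 2) * norm (g x) powr (p - 2) * (g x \<bullet> A h) / (norm (g x))\<^sup>2)) (at x)"
    by (simp add: n[symmetric])
  from has_derivative_scaleR[OF this g] show ?thesis by simp
qed

lemma flux_divergence:
  fixes A :: "'a::euclidean_space \<Rightarrow> 'a"
  assumes "linear A"
  shows "(\<Sum>b\<in>Basis. (norm \<xi> powr (p - 2) *\<^sub>R A b
       + ((p - 2) * norm \<xi> powr (p - 2) * (\<xi> \<bullet> A b) / (norm \<xi>)\<^sup>2) *\<^sub>R \<xi>) \<bullet> b)
     = pointwise_p_Laplacian p \<xi> A"
proof -
  have "\<xi> \<bullet> A \<xi> = (\<Sum>b\<in>Basis. (\<xi> \<bullet> A b) * (\<xi> \<bullet> b))"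
    using arg_cong[OF linear_basis_expansion[OF assms, of \<xi>], of "\<lambda>v. \<xi> \<bullet> v"]
    by (simp add: inner_sum_right mult.commute)
  then show ?thesis
    by (simp add: pointwise_p_Laplacian_def inner_add_left sum.distrib sum_distrib_left
        sum_distrib_right sum_divide_distrib algebra_simps)
qed

text \<open>A strict violation at x0 persists, by continuity, on a ball free of critical points.
  Testing with a bump supported there and integrating by parts gives a function that is positive on
  the ball but has integral at most 0.\<close>

lemma weak_le_imp_pointwise_le:
  fixes u :: "'a::euclidean_space \<Rightarrow> real"
  assumes S: "open S"
    and u: "\<And>x. x \<in> S \<Longrightarrow> (u has_derivative (\<lambda>h. g x \<bullet> h)) (at x)"
    and g: "\<And>x. x \<in> S \<Longrightarrow> (g has_derivative D x) (at x)"
    and D: "\<And>w. continuous_on S w \<Longrightarrow> continuous_on S (\<lambda>x. D x (w x))"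
    and f: "continuous_on S f"
    and weak: "neg_p_Laplacian_le p S u f"
    and x0: "x0 \<in> S" "g x0 \<noteq> 0"
  shows "- pointwise_p_Laplacian p (g x0) (D x0) \<le> f x0"
proof (rule ccontr)
  let ?L = "\<lambda>x. pointwise_p_Laplacian p (g x) (D x)"
  assume "\<not> - ?L x0 \<le> f x0"
  then have neg: "f x0 + ?L x0 < 0" by simp
  have contg: "continuous_on S g"
    using g by (auto intro!: continuous_at_imp_continuous_on has_derivative_continuous)
  \<comment> \<open>For p < 2 the field |g|^(p-2) g need not be differentiable at zeros of g; on
    \<open>T\<close> it is.\<close>
  define T where "T = {x \<in> S. g x \<noteq> 0}"
  have T: "open T" "T \<subseteq> S" "x0 \<in> T"
  proof -
    have "T = S \<inter> g -` (- {0})" by (auto simp: T_def)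
    moreover have "open (S \<inter> g -` (- {0}))"
      by (rule continuous_open_preimage[OF contg S]) auto
    ultimately show "open T" by simp
  qed (use x0 in \<open>auto simp: T_def\<close>)
  have DT: "continuous_on T (\<lambda>x. D x (w x))" if "continuous_on S w" for w
    using D[OF that] T(2) continuous_on_subset by blast
  have gT: "continuous_on T g" using contg T(2) continuous_on_subset by blast
  have contL: "continuous_on T ?L"
    unfolding pointwise_p_Laplacian_def
    by (intro continuous_intros DT contg gT) (auto simp: T_def)
  have contfL: "continuous_on T (\<lambda>x. f x + ?L x)"
    by (intro continuous_intros contL continuous_on_subset[OF f T(2)])
  have "open (T \<inter> (\<lambda>x. f x + ?L x) -` {..<0})"
    by (rule continuous_open_preimage[OF contfL T(1)]) simp
  moreover have "x0 \<in> T \<inter> (\<lambda>x. f x + ?L x) -` {..<0}" using T neg by simp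
  ultimately obtain r where r: "r > 0" "cball x0 r \<subseteq> T \<inter> (\<lambda>x. f x + ?L x) -` {..<0}"
    by (meson open_contains_cball)
  then have rT: "cball x0 r \<subseteq> T" and rneg: "\<And>x. x \<in> cball x0 r \<Longrightarrow> f x + ?L x < 0" by auto
  obtain \<phi> where \<phi>: "\<And>k. Ck_on k \<phi> UNIV" "\<And>x. \<phi> x \<ge> (0::real)" "\<And>x. \<phi> x \<noteq> 0 \<longleftrightarrow> x \<in> ball x0 r"
    using bump_function_exists[OF r(1)] by blast
  have supp: "{x. \<phi> x \<noteq> 0} = ball x0 r" by (simp only: \<phi>(3) Collect_mem_eq)
  have \<phi>0: "\<phi> x = 0" if "x \<notin> ball x0 r" for x using \<phi>(3) that by blast
  have cl: "closure {x. \<phi> x \<noteq> 0} = cball x0 r" using r(1) by (simp add: supp)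
  have test: "nonneg_test_function S \<phi>"
    unfolding nonneg_test_function_def cl
    using \<phi>(1,2) order_trans[OF rT T(2)] compact_cball by blast
  have "Ck_on (Suc 0) \<phi> UNIV" by (rule \<phi>(1))
  then have d\<phi>_diff: "\<And>x. \<phi> differentiable (at x)"
    and d\<phi>_cont: "\<And>b. b \<in> Basis \<Longrightarrow> continuous_on UNIV (\<lambda>x. frechet_derivative \<phi> (at x) b)" by auto
  define d where "d x = frechet_derivative \<phi> (at x)" for x
  have d: "(\<phi> has_derivative d x) (at x)" for x
    unfolding d_def using d\<phi>_diff[of x] by (simp only: frechet_derivative_works)
  have d_cont: "continuous_on C (\<lambda>x. d x b)" if "b \<in> Basis" for b C
    using d\<phi>_cont[OF that] unfolding d_def by (rule continuous_on_subset) simp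
  have \<phi>_cont: "continuous_on C \<phi>" for C
    using d by (auto intro!: continuous_at_imp_continuous_on has_derivative_continuous)
  define X where "X x = norm (g x) powr (p - 2) *\<^sub>R g x" for x
  define DX where "DX x h = norm (g x) powr (p - 2) *\<^sub>R D x h
       + ((p - 2) * norm (g x) powr (p - 2) * (g x \<bullet> D x h) / (norm (g x))\<^sup>2) *\<^sub>R g x" for x h
  have X: "(X has_derivative DX x) (at x)" if "x \<in> T" for x
    unfolding X_def DX_def using that by (intro flux_has_derivative g) (auto simp: T_def)
  have contX: "continuous_on T X"
    using X by (auto intro!: continuous_at_imp_continuous_on has_derivative_continuous)
  have contDX: "continuous_on T (\<lambda>x. DX x b)" for b
    unfolding DX_def by (intro continuous_intros DT contg gT) (auto simp: T_def)
  have divX: "(\<Sum>b\<in>Basis. DX x b \<bullet> b) = ?L x" if "x \<in> T" for x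
    unfolding DX_def using flux_divergence g[THEN has_derivative_linear] that T(2) by blast
  define F where "F b x = \<phi> x * (X x \<bullet> b)" for b x
  \<comment> \<open>The field X is differentiable only on \<open>T\<close>. Since \<phi> vanishes
    off the ball, extending by 0 still gives the derivative of F at every point; on the sphere the
    product rule applies, as the closed ball lies in \<open>T\<close>.\<close>
  define F' where "F' b x h = (if x \<in> cball x0 r then \<phi> x * (DX x h \<bullet> b) + d x h * (X x \<bullet> b) else 0)" for b x h
  have F: "(F b has_derivative F' b x) (at x)" for b x
  proof (cases "x \<in> cball x0 r")
    case True
    then have "((\<lambda>x. X x \<bullet> b) has_derivative (\<lambda>h. DX x h \<bullet> b)) (at x)"
      using X rT by (auto intro!: has_derivative_inner_left)
    from has_derivative_mult[OF d this] True show ?thesis by (simp add: F_def[abs_def] F'_def[abs_def])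
  next
    case False
    have "((\<lambda>x. 0) has_derivative F' b x) (at x)" using False by (simp add: F'_def[abs_def])
    moreover have "open (- cball x0 r)" "x \<in> - cball x0 r" using False by auto
    ultimately show ?thesis
      by (rule has_derivative_transform_within_open) (auto simp: F_def intro!: \<phi>0)
  qed
  have Fs: "F b x = 0" if "norm x > norm x0 + r" for b x
  proof -
    have "dist x0 x \<ge> norm x - norm x0" by (metis dist_norm norm_minus_commute norm_triangle_ineq2)
    then show ?thesis using that \<phi>0[of x] by (auto simp: F_def)
  qed
  have zero: "integrable lborel (\<lambda>x. F' b x b) \<and> (LINT x|lborel. F' b x b) = 0" if b: "b \<in> Basis" for b
  proof -
    have "continuous_on (cball x0 r) (\<lambda>x. \<phi> x * (DX x b \<bullet> b) + d x b * (X x \<bullet> b))"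
      using contX contDX rT by (intro continuous_intros \<phi>_cont d_cont b) (auto intro: continuous_on_subset)
    then have "compact ((\<lambda>x. \<phi> x * (DX x b \<bullet> b) + d x b * (X x \<bullet> b)) ` cball x0 r)"
      by (rule compact_continuous_image) simp
    from compact_imp_bounded[OF this] obtain B where "\<forall>y\<in>(\<lambda>x. \<phi> x * (DX x b \<bullet> b) + d x b * (X x \<bullet> b)) ` cball x0 r. norm y \<le> B"
      unfolding bounded_iff ..
    then have B: "\<bar>\<phi> x * (DX x b \<bullet> b) + d x b * (X x \<bullet> b)\<bar> \<le> B" if "x \<in> cball x0 r" for x
      using that by simp
    have "\<bar>F' b x b\<bar> \<le> max B 0" for x
      using B[of x] by (auto simp: F'_def)
    from integral_directional_derivative_eq_0[of "F b" "F' b", OF F Fs this] show ?thesis by auto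
  qed
  have gradphi: "grad \<phi> x \<bullet> v = (\<Sum>b\<in>Basis. (v \<bullet> b) * d x b)" for x v
  proof -
    have "(\<lambda>h. (\<Sum>b\<in>Basis. d x b *\<^sub>R b) \<bullet> h) = d x"
    proof (rule ext)
      fix h show "(\<Sum>b\<in>Basis. d x b *\<^sub>R b) \<bullet> h = d x h"
        using linear_basis_expansion[OF has_derivative_linear[OF d[of x]], of h]
        by (simp add: inner_sum_left inner_commute[of h] mult.commute)
    qed
    then have "grad \<phi> x = (\<Sum>b\<in>Basis. d x b *\<^sub>R b)" using grad_eqI[of \<phi> _ x] d by metis
    then show ?thesis
      by (simp add: inner_sum_left) (simp add: inner_commute mult.commute)
  qed
  define J where "J x = \<phi> x * ?L x" for x
  have iJ: "integrable lborel J" and iJf: "integrable lborel (\<lambda>x. \<phi> x * f x)"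
  proof -
    have *: "integrable lborel (\<lambda>x. \<phi> x * k x)" if "continuous_on T k" for k
    proof -
      have "integrable lborel (\<lambda>x. indicator (cball x0 r) x *\<^sub>R (\<phi> x * k x))"
        using that rT by (intro borel_integrable_compact continuous_intros \<phi>_cont) (auto intro: continuous_on_subset)
      moreover have "indicator (cball x0 r) x *\<^sub>R (\<phi> x * k x) = \<phi> x * k x" for x
        using \<phi>0[of x] by (auto simp: indicator_def)
      ultimately show ?thesis by (simp only:)
    qed
    show "integrable lborel J" unfolding J_def by (rule *[OF contL])
    show "integrable lborel (\<lambda>x. \<phi> x * f x)" by (rule *[OF continuous_on_subset[OF f T(2)]])
  qed
  have d0: "d x = (\<lambda>h. 0)" if "x \<notin> cball x0 r" for x
  proof -
    have "((\<lambda>x. 0) has_derivative (\<lambda>h. 0)) (at x)" by simp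
    moreover have "open (- cball x0 r)" "x \<in> - cball x0 r" using that by auto
    ultimately have "(\<phi> has_derivative (\<lambda>h. 0)) (at x)"
      by (rule has_derivative_transform_within_open) (simp add: \<phi>0)
    then show ?thesis using d has_derivative_unique by blast
  qed
  \<comment> \<open>The identity X \<bullet> grad \<phi> = div(\<phi> X) - \<phi> div X; the
    divergence term integrates to 0 by \<open>zero\<close>.\<close>
  have integrand: "indicator S x *\<^sub>R (p_flux p u x \<bullet> grad \<phi> x) = (\<Sum>b\<in>Basis. F' b x b) - J x" for x
  proof (cases "x \<in> cball x0 r")
    case True
    then have "x \<in> T" "x \<in> S" using rT T(2) by auto
    have "p_flux p u x = X x"
      using grad_eqI[OF u[OF \<open>x \<in> S\<close>]] by (simp add: p_flux_def X_def)
    moreover have "(\<Sum>b\<in>Basis. F' b x b) = \<phi> x * (\<Sum>b\<in>Basis. DX x b \<bullet> b) + (\<Sum>b\<in>Basis. (X x \<bullet> b) * d x b)"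
      using True by (simp add: F'_def sum.distrib sum_distrib_left mult.commute)
    ultimately show ?thesis
      using \<open>x \<in> S\<close> divX[OF \<open>x \<in> T\<close>] gradphi[of x "X x"] by (simp add: J_def inner_commute)
  next
    case False
    then have "grad \<phi> x = 0" using gradphi[of x "grad \<phi> x"] d0[of x] by simp
    moreover have "\<phi> x = 0" using False \<phi>0 by simp
    ultimately show ?thesis using False by (simp add: F'_def J_def)
  qed
  have "neg_p_Laplacian p S u \<phi> = - (LINT x|lborel. J x)"
    unfolding neg_p_Laplacian_def set_lebesgue_integral_def integrand
    using zero iJ by (subst Bochner_Integration.integral_diff) (auto intro!: Bochner_Integration.integrable_sum)
  moreover have "(LINT x:S|lborel. f x * \<phi> x) = (LINT x|lborel. \<phi> x * f x)"
    unfolding set_lebesgue_integral_def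
  proof (rule Bochner_Integration.integral_cong)
    fix x
    show "indicator S x *\<^sub>R (f x * \<phi> x) = \<phi> x * f x"
    proof (cases "x \<in> ball x0 r")
      case True
      then have "x \<in> S" using rT T(2) ball_subset_cball by blast
      then show ?thesis by simp
    qed (simp add: \<phi>0)
  qed simp
  ultimately have pairing: "0 \<le> (LINT x|lborel. \<phi> x * f x) + (LINT x|lborel. J x)"
    using weak test by (auto simp: neg_p_Laplacian_le_def)
  \<comment> \<open>This is -\<phi> (f + div X) on the ball: nonnegative everywhere and positive on
    the open ball, while \<open>pairing\<close> makes its integral at most 0.\<close>
  define N where "N x = - (\<phi> x * f x + J x)" for x
  have iN: "integrable lborel N" unfolding N_def using iJ iJf by auto
  have "(LINT x|lborel. N x) \<le> 0"
    unfolding N_def using iJ iJf pairing by simp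
  moreover have N_pos: "N x > 0" if "x \<in> ball x0 r" for x
  proof -
    have "\<phi> x > 0" using that \<phi>(2)[of x] \<phi>(3)[of x] by simp
    moreover have "f x + ?L x < 0" using that rneg by simp
    ultimately have "\<phi> x * (f x + ?L x) < 0" by (rule mult_pos_neg)
    then show ?thesis by (simp add: N_def J_def algebra_simps)
  qed
  moreover have N_nonneg: "N x \<ge> 0" for x
    using N_pos[of x] \<phi>0[of x] by (cases "x \<in> ball x0 r") (auto simp: N_def J_def)
  ultimately have "(LINT x|lborel. N x) = 0"
    by (simp add: Bochner_Integration.integral_nonneg order_antisym)
  then have "AE x in lborel. N x = 0"
    using integral_nonneg_eq_0_iff_AE[OF iN] N_nonneg by simp
  then have "AE x in lborel. x \<notin> ball x0 r"
    by eventually_elim (use N_pos in force)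
  then have "emeasure lborel (ball x0 r) = 0"
    by (subst (asm) AE_iff_measurable[of "ball x0 r"]) auto
  then have "ball x0 r \<in> null_sets lebesgue"
    by (auto simp: null_sets_def)
  then show False
    using open_not_negligible[of "ball x0 r"] r(1) by (auto simp: negligible_iff_null_sets)
qed

subsection \<open>The maximum principle and radial functions\<close>

text \<open>If c > 0, then k' is positive just to the right of its zero at 0, and the mean value
  theorem pushes k above k 0.\<close>

lemma deriv2_nonpos_at_max:
  fixes k :: "real \<Rightarrow> real"
  assumes e: "e > 0"
    and k: "\<And>t. \<bar>t\<bar> < e \<Longrightarrow> (k has_real_derivative k' t) (at t)"
    and k': "(k' has_real_derivative c) (at 0)"
    and max: "\<And>t. \<bar>t\<bar> < e \<Longrightarrow> k t \<le> k 0"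
  shows "k' 0 = 0" "c \<le> 0"
proof -
  show z: "k' 0 = 0"
    by (rule DERIV_local_max[OF k e]) (use e max in auto)
  show "c \<le> 0"
  proof (rule ccontr)
    assume "\<not> c \<le> 0"
    then obtain d where d: "d > 0" "\<And>h. 0 < h \<Longrightarrow> h < d \<Longrightarrow> k' 0 < k' (0 + h)"
      using DERIV_pos_inc_right[OF k'] by auto
    define h where "h = min d e / 2"
    have h: "0 < h" "h < d" "h < e" using d e by (auto simp: h_def)
    obtain s where s: "0 < s" "s < h" "k h - k 0 = (h - 0) * k' s"
      using MVT2[of 0 h k k'] h k by auto
    have "k' s > 0" using d(2)[of s] s h z by simp
    then have "k h > k 0" using s h by (metis diff_gt_0_iff_gt diff_zero h(1) mult_pos_pos)
    then show False using max[of h] h by simp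
  qed
qed

text \<open>With \<open>P b = b - (b \<bullet> e) e\<close>, the trace of \<open>A\<close> on the orthogonal complement of the unit
  vector \<open>e\<close> is \<open>\<Sum>b. P b \<bullet> A (P b)\<close>, which needs no orthonormal basis adapted to \<open>e\<close>.\<close>

lemma trace_minus_quadratic_form:
  fixes A :: "'a::euclidean_space \<Rightarrow> 'a"
  assumes A: "linear A" and e: "norm e = 1"
  shows "(\<Sum>b\<in>Basis. A b \<bullet> b) - e \<bullet> A e
    = (\<Sum>b\<in>Basis. (b - (b \<bullet> e) *\<^sub>R e) \<bullet> A (b - (b \<bullet> e) *\<^sub>R e))"
proof -
  have 1: "(\<Sum>b\<in>Basis. (b \<bullet> e) * (e \<bullet> A b)) = e \<bullet> A e"
    using arg_cong[OF linear_basis_expansion[OF A, of e], of "\<lambda>v. e \<bullet> v"]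
    by (simp add: inner_sum_right inner_commute[of e])
  have 2: "(\<Sum>b\<in>Basis. (b \<bullet> e) * (b \<bullet> A e)) = e \<bullet> A e"
    using euclidean_inner[of e "A e"] by (simp add: inner_commute)
  have 3: "(\<Sum>b\<in>Basis. (b \<bullet> e) * ((b \<bullet> e) * (e \<bullet> A e))) = e \<bullet> A e"
  proof -
    have "(\<Sum>b\<in>Basis. (b \<bullet> e) * (b \<bullet> e)) = 1"
      using euclidean_inner[of e e] e by (simp add: inner_commute norm_eq_1)
    then show ?thesis by (simp add: mult.assoc[symmetric] sum_distrib_right[symmetric])
  qed
  have "(b - (b \<bullet> e) *\<^sub>R e) \<bullet> A (b - (b \<bullet> e) *\<^sub>R e)
      = A b \<bullet> b - (b \<bullet> e) * (e \<bullet> A b) - (b \<bullet> e) * (b \<bullet> A e) + (b \<bullet> e) * ((b \<bullet> e) * (e \<bullet> A e))" for b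
    by (simp add: linear_diff[OF A] linear_cmul[OF A] inner_diff_left inner_diff_right
        inner_commute[of "A b" b] algebra_simps)
  then show ?thesis
    by (simp add: sum.distrib sum_subtractf 1 2 3)
qed

text \<open>Ellipticity of the operator. The coefficient p - 2 may be negative, so the direction e
  of \<xi> is split off: what remains is the trace on its orthogonal complement plus (p - 1) times
  the quadratic form at e, and both weights are positive.\<close>

lemma pointwise_p_Laplacian_mono:
  fixes A B :: "'a::euclidean_space \<Rightarrow> 'a"
  assumes A: "linear A" and B: "linear B" and p: "p > 1" and \<xi>: "\<xi> \<noteq> 0"
    and le: "\<And>h. h \<bullet> A h \<le> h \<bullet> B h"
  shows "pointwise_p_Laplacian p \<xi> A \<le> pointwise_p_Laplacian p \<xi> B"
proof -
  define e where "e = (1 / norm \<xi>) *\<^sub>R \<xi>"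
  have e: "norm e = 1" using \<xi> by (simp add: e_def)
  have split: "(\<Sum>b\<in>Basis. T b \<bullet> b) + (p - 2) * (\<xi> \<bullet> T \<xi>) / (norm \<xi>)\<^sup>2
      = (\<Sum>b\<in>Basis. (b - (b \<bullet> e) *\<^sub>R e) \<bullet> T (b - (b \<bullet> e) *\<^sub>R e)) + (p - 1) * (e \<bullet> T e)"
    if T: "linear T" for T
  proof -
    have "(\<xi> \<bullet> T \<xi>) / (norm \<xi>)\<^sup>2 = e \<bullet> T e"
      by (simp add: e_def linear_cmul[OF T] power2_eq_square)
    then have "(p - 2) * (\<xi> \<bullet> T \<xi>) / (norm \<xi>)\<^sup>2 = (p - 2) * (e \<bullet> T e)"
      by (metis times_divide_eq_right)
    with trace_minus_quadratic_form[OF T e] show ?thesis by (simp add: algebra_simps)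
  qed
  show ?thesis
    unfolding pointwise_p_Laplacian_def split[OF A] split[OF B]
    by (intro mult_left_mono add_mono sum_mono le) (use p in auto)
qed

text \<open>Restricting u - v to each line through x reduces the claim to the one-variable test,
  which gives equal gradients and ordered Hessian forms; ellipticity then compares the
  operators.\<close>

lemma p_Laplacian_le_at_max:
  fixes u v :: "'a::euclidean_space \<Rightarrow> real"
  assumes S: "open S" "x \<in> S" and p: "p > 1"
    and u: "\<And>y. y \<in> S \<Longrightarrow> (u has_derivative (\<lambda>h. gu y \<bullet> h)) (at y)"
    and v: "\<And>y. y \<in> S \<Longrightarrow> (v has_derivative (\<lambda>h. gv y \<bullet> h)) (at y)"
    and gu: "(gu has_derivative A) (at x)" and gv: "(gv has_derivative B) (at x)"
    and nz: "gv x \<noteq> 0"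
    and max: "\<And>y. y \<in> S \<Longrightarrow> u y - v y \<le> u x - v x"
  shows "gu x = gv x" "pointwise_p_Laplacian p (gu x) A \<le> pointwise_p_Laplacian p (gv x) B"
proof -
  have "(gu x - gv x) \<bullet> h = 0 \<and> h \<bullet> A h \<le> h \<bullet> B h" for h
  proof -
    obtain r where r: "r > 0" "ball x r \<subseteq> S" using S open_contains_ball by blast
    define e where "e = r / (norm h + 1)"
    have e: "e > 0" using r by (simp add: e_def add_nonneg_pos)
    have inS: "x + t *\<^sub>R h \<in> S" if "\<bar>t\<bar> < e" for t
    proof -
      have "\<bar>t\<bar> * norm h \<le> \<bar>t\<bar> * (norm h + 1)" by (simp add: mult_left_mono)
      also have "\<dots> < r" using that by (simp add: e_def pos_less_divide_eq add_nonneg_pos)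
      finally have "x + t *\<^sub>R h \<in> ball x r" by (simp add: dist_norm)
      then show ?thesis using r by blast
    qed
    define k where "k t = u (x + t *\<^sub>R h) - v (x + t *\<^sub>R h)" for t
    define k' where "k' t = (gu (x + t *\<^sub>R h) - gv (x + t *\<^sub>R h)) \<bullet> h" for t
    have line: "((\<lambda>t. x + t *\<^sub>R h) has_derivative (\<lambda>t. t *\<^sub>R h)) (at t)" for t :: real
      by (auto intro!: derivative_eq_intros)
    have 1: "(k has_real_derivative k' t) (at t)" if "\<bar>t\<bar> < e" for t
      unfolding has_field_derivative_def k_def[abs_def] k'_def
      using has_derivative_diff[OF has_derivative_compose[OF line u[OF inS[OF that]]]
          has_derivative_compose[OF line v[OF inS[OF that]]]]
      by (rule has_derivative_eq_rhs) (simp add: inner_diff_left fun_eq_iff algebra_simps)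
    have lin: "linear A" "linear B" using gu gv has_derivative_linear by blast+
    have "((\<lambda>t. gu (x + t *\<^sub>R h)) has_derivative (\<lambda>t. A (t *\<^sub>R h))) (at 0)"
      "((\<lambda>t. gv (x + t *\<^sub>R h)) has_derivative (\<lambda>t. B (t *\<^sub>R h))) (at 0)"
      using has_derivative_compose[OF line[of 0], of gu A] has_derivative_compose[OF line[of 0], of gv B] gu gv
      by simp_all
    from has_derivative_inner_left[OF has_derivative_diff[OF this], of h]
    have 2: "(k' has_real_derivative (A h - B h) \<bullet> h) (at 0)"
      unfolding has_field_derivative_def k'_def[abs_def]
      by (simp add: linear_cmul[OF lin(1)] linear_cmul[OF lin(2)] scaleR_diff_right[symmetric] mult_commute_abs)
    have 3: "k t \<le> k 0" if "\<bar>t\<bar> < e" for t using max[OF inS[OF that]] by (simp add: k_def)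
    from deriv2_nonpos_at_max[OF e 1 2 3] show ?thesis
      by (simp add: k'_def inner_diff_left inner_diff_right inner_commute)
  qed
  then have *: "(gu x - gv x) \<bullet> h = 0" "h \<bullet> A h \<le> h \<bullet> B h" for h by auto
  show eq: "gu x = gv x" using *(1)[of "gu x - gv x"] by simp
  show "pointwise_p_Laplacian p (gu x) A \<le> pointwise_p_Laplacian p (gv x) B"
    unfolding eq using gu gv has_derivative_linear p nz *(2) by (intro pointwise_p_Laplacian_mono) auto
qed

lemma radial_gradient:
  fixes x :: "'a::euclidean_space"
  assumes "x \<noteq> 0" and V: "(V has_real_derivative - W (norm x)) (at (norm x))"
  shows "((\<lambda>x. V (norm x)) has_derivative (\<lambda>h. (- (W (norm x) / norm x) *\<^sub>R x) \<bullet> h)) (at x)"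
proof -
  have "(norm has_derivative (\<lambda>h. (sgn x) \<bullet> h)) (at x)"
    using has_derivative_norm[OF assms(1)] by (simp add: inner_commute)
  from has_derivative_compose[OF this V[unfolded has_field_derivative_def]]
  show ?thesis by (simp add: sgn_div_norm field_simps)
qed

text \<open>Here W = -V'. The Hessian has x as eigenvector with eigenvalue -w and acts as -W/r on
  its orthogonal complement, which yields the radial form W^(p-2) ((p-1) W' + (n-1) W/r) of -Delta_p
  V when W > 0.\<close>

lemma radial_hessian:
  fixes x :: "'a::euclidean_space"
  assumes x: "x \<noteq> 0" and W: "(W has_real_derivative w) (at (norm x))" "W (norm x) \<noteq> 0"
  defines "A \<equiv> \<lambda>h. - (((w * norm x - W (norm x)) * (x \<bullet> h) / norm x ^ 3) *\<^sub>R x + (W (norm x) / norm x) *\<^sub>R h)"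
  shows "((\<lambda>x. - (W (norm x) / norm x) *\<^sub>R x) has_derivative A) (at x)"
    and "pointwise_p_Laplacian p (- (W (norm x) / norm x) *\<^sub>R x) A
      = - (\<bar>W (norm x)\<bar> powr (p - 2) * ((p - 1) * w + (real DIM('a) - 1) * W (norm x) / norm x))"
proof -
  let ?r = "norm x"
  have r: "?r > 0" using x by simp
  have n: "(norm has_derivative (\<lambda>h. (sgn x) \<bullet> h)) (at x)"
    using has_derivative_norm[OF x] by (simp add: inner_commute)
  have "((\<lambda>r. W r / r) has_real_derivative (w * ?r - W ?r) / (?r)\<^sup>2) (at ?r)"
    using r by (auto intro!: derivative_eq_intros W simp: power2_eq_square)
  from has_derivative_compose[OF n this[unfolded has_field_derivative_def]]
  have "((\<lambda>x. W (norm x) / norm x) has_derivative (\<lambda>h. (w * ?r - W ?r) / (?r)\<^sup>2 * (sgn x \<bullet> h))) (at x)" .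
  from has_derivative_scaleR[OF has_derivative_minus[OF this] has_derivative_ident]
  show "((\<lambda>x. - (W (norm x) / norm x) *\<^sub>R x) has_derivative A) (at x)"
    by (rule has_derivative_eq_rhs)
      (auto simp: A_def fun_eq_iff sgn_div_norm power2_eq_square power3_eq_cube field_simps)
  let ?\<xi> = "- (W ?r / ?r) *\<^sub>R x"
  have tr: "(\<Sum>b\<in>Basis. A b \<bullet> b) = - ((w * ?r - W ?r) / ?r + real DIM('a) * (W ?r / ?r))"
  proof -
    define c where "c = (w * ?r - W ?r) / ?r ^ 3"
    have "A b \<bullet> b = - (c * ((x \<bullet> b) * (x \<bullet> b)) + W ?r / ?r)" if "b \<in> Basis" for b
      using that by (simp add: A_def c_def inner_diff_left)
    then have "(\<Sum>b\<in>Basis. A b \<bullet> b)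
        = - (c * (\<Sum>b\<in>Basis. (x \<bullet> b) * (x \<bullet> b)) + real DIM('a) * (W ?r / ?r))"
      by (simp add: sum_subtractf sum_negf sum_distrib_left)
    also have "(\<Sum>b\<in>Basis. (x \<bullet> b) * (x \<bullet> b)) = ?r * ?r"
      using euclidean_inner[of x x] by (simp add: dot_square_norm power2_eq_square)
    also have "c * (?r * ?r) = (w * ?r - W ?r) / ?r"
      using r by (simp add: c_def power3_eq_cube)
    finally show ?thesis .
  qed
  have q: "?\<xi> \<bullet> A ?\<xi> / (norm ?\<xi>)\<^sup>2 = - w"
  proof -
    define k where "k = - (W ?r / ?r)"
    have "A ?\<xi> = - (((w * ?r - W ?r) * (k * (?r * ?r)) / ?r ^ 3) *\<^sub>R x + (W ?r / ?r * k) *\<^sub>R x)"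
      by (simp add: A_def k_def dot_square_norm power2_eq_square)
    also have "\<dots> = - (((w * ?r - W ?r) * (k * (?r * ?r)) / ?r ^ 3 + W ?r / ?r * k) *\<^sub>R x)"
      by (simp only: scaleR_add_left)
    also have "(w * ?r - W ?r) * (k * (?r * ?r)) / ?r ^ 3 + W ?r / ?r * k = w * k"
      using r by (simp add: power3_eq_cube field_simps)
    finally have "A ?\<xi> = (- w) *\<^sub>R ?\<xi>" by (simp add: k_def)
    moreover have "?\<xi> \<bullet> ?\<xi> = (norm ?\<xi>)\<^sup>2" by (rule dot_square_norm)
    moreover have "norm ?\<xi> \<noteq> 0" using x W(2) by simp
    ultimately show ?thesis by (simp only: inner_scaleR_right) simp
  qed
  have nn: "norm ?\<xi> = \<bar>W ?r\<bar>" using r by simp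
  show "pointwise_p_Laplacian p ?\<xi> A
      = - (\<bar>W ?r\<bar> powr (p - 2) * ((p - 1) * w + (real DIM('a) - 1) * W ?r / ?r))"
  proof -
    have "(p - 2) * (?\<xi> \<bullet> A ?\<xi>) / (norm ?\<xi>)\<^sup>2 = (p - 2) * - w"
      using q by (metis times_divide_eq_right)
    then have "pointwise_p_Laplacian p ?\<xi> A = \<bar>W ?r\<bar> powr (p - 2)
        * (- ((w * ?r - W ?r) / ?r + real DIM('a) * (W ?r / ?r)) + (p - 2) * - w)"
      by (simp only: pointwise_p_Laplacian_def tr nn)
    then show ?thesis using r by (simp add: field_simps)
  qed
qed

subsection \<open>Iterated logarithms\<close>

lemma iter_log_0 [simp]: "iter_log 0 y = y"
  and iter_log_Suc [simp]: "iter_log (Suc j) y = ln (iter_log j y)"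
  by (simp_all add: iter_log_def)

lemma iter_log_mono:
  assumes "\<And>i. i < j \<Longrightarrow> iter_log i y > 0" "y \<le> z"
  shows "iter_log j y \<le> iter_log j z"
  using assms
proof (induction j)
  case (Suc j)
  then have "iter_log j y \<le> iter_log j z" "0 < iter_log j y" by auto
  then show ?case by simp
qed simp

lemma filterlim_iter_log: "filterlim (iter_log j) at_top at_top"
proof (induction j)
  case 0
  then show ?case by (simp add: filterlim_ident iter_log_0[abs_def])
next
  case (Suc j)
  then show ?case
    using filterlim_compose[OF ln_at_top Suc] by (simp add: iter_log_Suc[abs_def])
qed

lemma iter_log_DERIV:
  assumes "\<And>i. i < j \<Longrightarrow> iter_log i y > 0"
  shows "(iter_log j has_real_derivative inverse (\<Prod>i<j. iter_log i y)) (at y)"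
  using assms
proof (induction j)
  case 0
  then show ?case by (simp add: iter_log_0[abs_def])
next
  case (Suc j)
  then have d: "(iter_log j has_real_derivative inverse (\<Prod>i<j. iter_log i y)) (at y)"
    and pos: "iter_log j y > 0" by auto
  from DERIV_chain2[OF DERIV_ln[OF pos] d] show ?case
    by (simp add: iter_log_Suc[abs_def] mult.commute)
qed

text \<open>The denominator in the upper bound for -Delta_p u. The iterate with index 0 is left out;
  in the derivative of \<open>iter_log Q\<close> that missing factor y is cancelled by the
  derivative of y = r^(-a).\<close>

definition log_product :: "nat \<Rightarrow> real \<Rightarrow> real \<Rightarrow> real" where
  "log_product Q \<beta> y = (\<Prod>j\<in>{1..<Q}. iter_log j y) * iter_log Q y powr \<beta>"

lemma log_product_pos:
  assumes "Q \<ge> 1" "\<And>j. j \<in> {1..Q} \<Longrightarrow> iter_log j y > 0"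
  shows "log_product Q \<beta> y > 0"
proof -
  have "iter_log Q y > 0" using assms by auto
  moreover have "(\<Prod>j\<in>{1..<Q}. iter_log j y) > 0" by (rule prod_pos) (use assms in auto)
  ultimately show ?thesis by (simp add: log_product_def)
qed

lemma log_product_mono:
  assumes "\<And>i. i \<le> Q \<Longrightarrow> iter_log i y > 0" "y \<le> z" "\<beta> \<ge> 0"
  shows "log_product Q \<beta> y \<le> log_product Q \<beta> z"
proof -
  have m: "iter_log i y \<le> iter_log i z" if "i \<le> Q" for i
    by (rule iter_log_mono) (use assms that in auto)
  show ?thesis
    unfolding log_product_def
  proof (intro mult_mono prod_mono powr_mono2)
    show "0 \<le> iter_log i y \<and> iter_log i y \<le> iter_log i z" if "i \<in> {1..<Q}" for i
      using m[of i] assms(1)[of i] that by simp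
    show "0 \<le> (\<Prod>j\<in>{1..<Q}. iter_log j z)"
    proof (rule prod_nonneg)
      show "0 \<le> iter_log i z" if "i \<in> {1..<Q}" for i
        using order_trans[OF less_imp_le[OF assms(1)[of i]] m[of i]] that by simp
    qed
  qed (use m[of Q] assms in \<open>auto simp: less_imp_le\<close>)
qed

text \<open>The weight \<open>m r = a / log_product Q \<beta> (r\<^sup>-\<^sup>a)\<close> is Dini integrable at \<open>0\<close> because \<open>\<beta> > 1\<close>;
  \<open>M r = (iter_log Q (r\<^sup>-\<^sup>a))\<^sup>1\<^sup>-\<^sup>\<beta> / (\<beta> - 1)\<close> is its integral against \<open>dr / r\<close>.\<close>

lemma dini_weight_exists:
  fixes a \<beta> \<kappa> :: real
  assumes Q: "Q \<ge> 1" and \<beta>: "\<beta> > 1" and a: "a > 0" and \<kappa>: "\<kappa> > 0"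
  obtains M \<rho> where "\<rho> > 0" "\<rho> < 1"
    "\<And>r j. 0 < r \<Longrightarrow> r < \<rho> \<Longrightarrow> j \<le> Q \<Longrightarrow> iter_log j (r powr - a) > 0"
    "\<And>r. 0 < r \<Longrightarrow> r < \<rho> \<Longrightarrow> (M has_real_derivative a / log_product Q \<beta> (r powr - a) / r) (at r)"
    "\<And>r. 0 < r \<Longrightarrow> r < \<rho> \<Longrightarrow> 0 \<le> M r \<and> M r \<le> 1 / 2"
    "\<And>r. 0 < r \<Longrightarrow> r < \<rho> \<Longrightarrow> a / log_product Q \<beta> (r powr - a) \<le> \<kappa>"
proof -
  have y_lim: "filterlim (\<lambda>r::real. r powr - a) at_top (at_right 0)"
    using a by real_asymp
  have L: "filterlim (\<lambda>r. iter_log j (r powr - a)) at_top (at_right 0)" for j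
    by (rule filterlim_compose[OF filterlim_iter_log y_lim])
  \<comment> \<open>The bound 1 makes all iterates positive and their product at least 1, the bound
    a/\<kappa> gives the estimate of the weight by \<kappa>, and the last entry gives M \<le>
    1/2.\<close>
  define c where "c = max 1 (max (a / \<kappa>) ((2 / (\<beta> - 1)) powr (1 / (\<beta> - 1))))"
  have "\<forall>\<^sub>F r in at_right 0. \<forall>j\<in>{..Q}. iter_log j (r powr - a) \<ge> c"
    using L by (auto simp: eventually_ball_finite_distrib filterlim_at_top)
  then obtain \<rho>0 where \<rho>0: "\<rho>0 > 0" "\<And>r j. 0 < r \<Longrightarrow> r < \<rho>0 \<Longrightarrow> j \<le> Q \<Longrightarrow> iter_log j (r powr - a) \<ge> c"
    by (auto simp: eventually_at_right[of 0 1, simplified])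
  define \<rho> where "\<rho> = min \<rho>0 (1 / 2)"
  have \<rho>: "\<rho> > 0" "\<rho> < 1" using \<rho>0 by (auto simp: \<rho>_def)
  have ge: "iter_log j (r powr - a) \<ge> c" if "0 < r" "r < \<rho>" "j \<le> Q" for r j
    using \<rho>0(2) that by (auto simp: \<rho>_def)
  have c1: "c \<ge> 1" "c \<ge> a / \<kappa>" "c \<ge> (2 / (\<beta> - 1)) powr (1 / (\<beta> - 1))" by (auto simp: c_def)
  have pos: "iter_log j (r powr - a) > 0" if "0 < r" "r < \<rho>" "j \<le> Q" for r j
    using ge[OF that] c1 by linarith
  define M where "M r = iter_log Q (r powr - a) powr (1 - \<beta>) / (\<beta> - 1)" for r
  have deriv: "(M has_real_derivative a / log_product Q \<beta> (r powr - a) / r) (at r)" if r: "0 < r" "r < \<rho>" for r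
  proof -
    let ?y = "r powr - a"
    have y: "((\<lambda>r. r powr - a) has_real_derivative - a * r powr (- a - 1)) (at r)"
      using r by (auto intro!: derivative_eq_intros)
    have d: "(iter_log Q has_real_derivative inverse (\<Prod>i<Q. iter_log i ?y)) (at ?y)"
      by (rule iter_log_DERIV) (use pos[OF r] in simp)
    have pw: "((\<lambda>t. t powr (1 - \<beta>)) has_real_derivative (1 - \<beta>) * iter_log Q ?y powr (1 - \<beta> - 1)) (at (iter_log Q ?y))"
      by (rule has_real_derivative_powr) (use pos[OF r] in simp)
    have "((\<lambda>r. iter_log Q (r powr - a)) has_real_derivative
        inverse (\<Prod>i<Q. iter_log i ?y) * (- a * r powr (- a - 1))) (at r)"
      by (rule DERIV_chain2[where f = "iter_log Q", OF d y])
    from DERIV_cdivide[OF DERIV_chain2[where f = "\<lambda>t. t powr (1 - \<beta>)" and g = "\<lambda>r. iter_log Q (r powr - a)", OF pw this]]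
    have "(M has_real_derivative (1 - \<beta>) * iter_log Q ?y powr (1 - \<beta> - 1)
        * (inverse (\<Prod>i<Q. iter_log i ?y) * (- a * r powr (- a - 1))) / (\<beta> - 1)) (at r)"
      unfolding M_def .
    \<comment> \<open>The factor with index 0 is \<open>?y\<close> itself; it cancels against dy/dr
      = -a y/r and leaves 1/r.\<close>
    also have "(\<Prod>i<Q. iter_log i ?y) = ?y * (\<Prod>j\<in>{1..<Q}. iter_log j ?y)"
      using Q by (simp add: lessThan_atLeast0 prod.atLeast_Suc_lessThan)
    also have "iter_log Q ?y powr (1 - \<beta> - 1) = inverse (iter_log Q ?y powr \<beta>)"
      by (simp add: powr_minus)
    also have "r powr (- a - 1) = ?y / r" using r by (simp add: powr_diff)
    also have "(1 - \<beta>) * inverse (iter_log Q ?y powr \<beta>) * (inverse (?y * (\<Prod>j\<in>{1..<Q}. iter_log j ?y))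
        * (- a * (?y / r))) / (\<beta> - 1) = a / log_product Q \<beta> ?y / r"
    proof -
      have "(1 - \<beta>) * A * (inverse (y * P) * (- a * (y / r))) / (\<beta> - 1) = a / (P * inverse A) / r"
        if "y > 0" for A y P
      proof -
        have "(1 - \<beta>) / (\<beta> - 1) = - 1" using \<beta> by (simp add: field_simps)
        moreover have "(1 - \<beta>) * A * (inverse (y * P) * (- a * (y / r))) / (\<beta> - 1)
            = ((1 - \<beta>) / (\<beta> - 1)) * - (A * (inverse (y * P) * y) * a / r)" by (simp add: ac_simps)
        moreover have "inverse (y * P) * y = inverse P" using that by simp
        ultimately have "(1 - \<beta>) * A * (inverse (y * P) * (- a * (y / r))) / (\<beta> - 1)
            = - 1 * - (A * inverse P * a / r)" by (simp only:)
        then show ?thesis by (simp add: divide_inverse ac_simps)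
      qed
      from this[of ?y] show ?thesis using r by (simp add: log_product_def)
    qed
    finally show ?thesis .
  qed
  have M: "0 \<le> M r \<and> M r \<le> 1 / 2" if r: "0 < r" "r < \<rho>" for r
  proof -
    have "iter_log Q (r powr - a) powr (1 - \<beta>) \<le> ((2 / (\<beta> - 1)) powr (1 / (\<beta> - 1))) powr (1 - \<beta>)"
      by (rule powr_mono2') (use ge[OF r, of Q] c1 \<beta> in auto)
    also have "\<dots> = (\<beta> - 1) / 2"
    proof -
      have "1 / (\<beta> - 1) * (1 - \<beta>) = - 1" using \<beta> by (simp add: field_simps)
      then show ?thesis using \<beta> by (simp only: powr_powr) (simp add: powr_minus)
    qed
    finally show ?thesis using \<beta> by (simp add: M_def field_simps)
  qed
  have m: "a / log_product Q \<beta> (r powr - a) \<le> \<kappa>" if r: "0 < r" "r < \<rho>" for r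
  proof -
    let ?l = "\<lambda>j. iter_log j (r powr - a)"
    have "?l Q \<ge> 1" using ge[OF r, of Q] c1 by simp
    have "a / \<kappa> \<le> ?l Q powr 1" using ge[OF r, of Q] c1 by simp
    also have "\<dots> \<le> ?l Q powr \<beta>" using \<open>?l Q \<ge> 1\<close> \<beta> by (intro powr_mono) auto
    also have "\<dots> \<le> (\<Prod>j\<in>{1..<Q}. ?l j) * ?l Q powr \<beta>"
    proof -
      have "(\<Prod>j\<in>{1..<Q}. ?l j) \<ge> 1"
      proof (rule prod_ge_1)
        show "1 \<le> ?l j" if "j \<in> {1..<Q}" for j using ge[OF r, of j] c1 that by simp
      qed
      then show ?thesis by (simp add: mult_le_cancel_right1)
    qed
    finally have "a / \<kappa> \<le> log_product Q \<beta> (r powr - a)" by (simp add: log_product_def)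
    moreover have "log_product Q \<beta> (r powr - a) > 0"
      by (rule log_product_pos) (use Q pos[OF r] in auto)
    ultimately show ?thesis using \<kappa> by (simp add: field_simps)
  qed
  show ?thesis by (rule that[OF \<rho> pos deriv M m])
qed

subsection \<open>The radial barrier\<close>

text \<open>The right-hand side is -Delta_p V for V' = -r^(-\<alpha>-1) G. Both sides carry r^(-n),
  so the claim reduces to comparing (\<eta> E)^q with a multiple of (\<eta> E)^(p-1); the quotient
  (\<eta> E)^(q-p+1) is controlled by \<open>small\<close> because E \<le> 2.\<close>

lemma barrier_flux_strict:
  fixes p \<alpha> q \<eta> E X G G' a r m n :: real
  assumes p: "p > 1" and \<alpha>: "\<alpha> > 0" and n: "(\<alpha> + 1) * (p - 1) = n - 1" "\<alpha> * q = n" and q: "q > p - 1"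
    and a: "a > 0" and \<eta>: "\<eta> > 0"
    and small: "(2 * \<eta>) powr (q - p + 1) < a * ((p - 1) * (1 / 2) powr \<bar>p - 2\<bar> * (\<alpha> / 4) powr (p - 1))"
    and r: "r > 0" and m: "m > 0" and E: "0 < E" "E \<le> 2"
    and X: "X = \<alpha> / 4 * (\<eta> * E)" and G: "X / 2 \<le> G" "G \<le> X" and G': "r * G' \<ge> X * m"
  shows "(\<eta> * r powr - \<alpha> * E) powr q * (m / a)
    < (r powr (- \<alpha> - 1) * G) powr (p - 2) * ((p - 1) * (r powr (- \<alpha> - 1) * G'))"
proof -
  \<comment> \<open>G lies between X/2 and X, so G^(p-2) is at least K X^(p-2); the absolute value
    in the exponent covers both signs of p - 2.\<close>
  define K where "K = (1 / 2 :: real) powr \<bar>p - 2\<bar>"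
  have K: "K > 0" by (simp add: K_def)
  have X0: "X > 0" unfolding X using \<alpha> \<eta> E by simp
  have G0: "G > 0" using G X0 by linarith
  have GK: "G powr (p - 2) \<ge> K * X powr (p - 2)"
  proof (cases "p \<ge> 2")
    case True
    have "K * X powr (p - 2) = (1 / 2 * X) powr (p - 2)"
      using True X0 by (simp add: K_def powr_mult[symmetric])
    also have "\<dots> \<le> G powr (p - 2)" using True G X0 by (intro powr_mono2) auto
    finally show ?thesis .
  next
    case False
    have "K \<le> (1 / 2) powr 0" unfolding K_def by (rule powr_mono') auto
    then have "K * X powr (p - 2) \<le> 1 * X powr (p - 2)" by (intro mult_right_mono) auto
    also have "\<dots> \<le> G powr (p - 2)" using False G G0 by (simp add: powr_mono2')
    finally show ?thesis .
  qed
  have "(\<eta> * E) powr (q - p + 1) \<le> (2 * \<eta>) powr (q - p + 1)"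
    using q \<eta> E by (intro powr_mono2) auto
  also note small
  finally have "(\<eta> * E) powr (q - p + 1) * (\<eta> * E) powr (p - 1)
      < a * ((p - 1) * K * (\<alpha> / 4) powr (p - 1)) * (\<eta> * E) powr (p - 1)"
    using \<eta> E by (intro mult_strict_right_mono) (auto simp: K_def)
  moreover have "(\<eta> * E) powr (q - p + 1) * (\<eta> * E) powr (p - 1) = (\<eta> * E) powr q"
    by (simp add: powr_add[symmetric])
  moreover have "(\<alpha> / 4) powr (p - 1) * (\<eta> * E) powr (p - 1) = X powr (p - 1)"
    unfolding X by (rule powr_mult[symmetric])
  ultimately have main: "(\<eta> * E) powr q < a * ((p - 1) * K * X powr (p - 1))"
    by (simp add: mult.assoc)
  have "(\<eta> * r powr - \<alpha> * E) powr q = (r powr - \<alpha> * (\<eta> * E)) powr q" by (simp add: ac_simps)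
  also have "\<dots> = r powr - n * (\<eta> * E) powr q"
    using n(2) by (simp add: powr_mult powr_powr)
  also have "\<dots> * (m / a) < r powr - n * (a * ((p - 1) * K * X powr (p - 1))) * (m / a)"
    using main r m a by (intro mult_strict_right_mono mult_strict_left_mono) auto
  also have "\<dots> = r powr - n * ((p - 1) * (K * X powr (p - 2)) * (X * m))"
  proof -
    have "X powr (p - 1) = X powr (p - 2) * X"
      using X0 powr_add[of X "p - 2" 1] by simp
    then show ?thesis using a by simp
  qed
  also have "\<dots> \<le> r powr - n * ((p - 1) * G powr (p - 2) * (r * G'))"
    by (intro mult_left_mono[OF mult_mono[OF mult_left_mono[OF GK] G']]) (use p X0 m in auto)
  also have "r powr - n * ((p - 1) * G powr (p - 2) * (r * G'))
      = (r powr (- \<alpha> - 1) * G) powr (p - 2) * ((p - 1) * (r powr (- \<alpha> - 1) * G'))"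
  proof -
    have "(r powr (- \<alpha> - 1)) powr (p - 2) * r powr (- \<alpha> - 1) = r powr ((- \<alpha> - 1) * (p - 2) + (- \<alpha> - 1))"
      by (simp only: powr_powr powr_add)
    also have "(- \<alpha> - 1) * (p - 2) + (- \<alpha> - 1) = - n + 1" using n(1) by (simp add: algebra_simps)
    also have "r powr (- n + 1) = r powr - n * r" using r powr_add[of r "- n" 1] by simp
    finally have e: "(r powr (- \<alpha> - 1)) powr (p - 2) * r powr (- \<alpha> - 1) = r powr - n * r" .
    have "(r powr (- \<alpha> - 1) * G) powr (p - 2) * ((p - 1) * (r powr (- \<alpha> - 1) * G'))
      = ((r powr (- \<alpha> - 1)) powr (p - 2) * r powr (- \<alpha> - 1)) * (G powr (p - 2) * (p - 1) * G')"
      by (simp add: powr_mult)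
    also have "\<dots> = r powr - n * ((p - 1) * G powr (p - 2) * (r * G'))"
      unfolding e by simp
    finally show ?thesis ..
  qed
  finally show ?thesis .
qed

lemma DERIV_le_0_imp_decreasing_on:
  fixes f :: "real \<Rightarrow> real"
  assumes "0 < r" "r \<le> R" "\<And>s. r \<le> s \<Longrightarrow> s \<le> R \<Longrightarrow> (f has_real_derivative f' s) (at s)"
    "\<And>s. r \<le> s \<Longrightarrow> s \<le> R \<Longrightarrow> f' s \<le> 0"
  shows "f R \<le> f r"
  by (rule DERIV_nonpos_imp_nonincreasing[OF assms(2)]) (use assms(3,4) in blast)

text \<open>Only the flux is prescribed, so V is an antiderivative, normalised at R by the bound for
  u on the outer sphere. Integrating the bounds on G inward from R gives both estimates: the lower
  one beats u = o(r^(-\<alpha>)) near 0, the upper one is the improved decay.\<close>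

lemma radial_barrier_exists:
  fixes G :: "real \<Rightarrow> real"
  assumes \<alpha>: "\<alpha> > 0" and \<eta>: "\<eta> > 0" and \<epsilon>: "0 < \<epsilon>" "\<epsilon> \<le> 1" and R: "0 < R" "R < \<rho>"
    and G_cont: "\<And>r. 0 < r \<Longrightarrow> r < \<rho> \<Longrightarrow> isCont G r"
    and G_ge: "\<And>r. 0 < r \<Longrightarrow> r < \<rho> \<Longrightarrow> \<alpha> / 4 * (\<eta> * \<epsilon>) / 2 \<le> G r"
    and G_le: "\<And>r. 0 < r \<Longrightarrow> r < \<rho> \<Longrightarrow> G r \<le> \<alpha> / 4 * (\<eta> * (\<epsilon> + (r / R) powr (\<alpha> / 2)))"
  obtains V where
    "\<And>r. 0 < r \<Longrightarrow> r < \<rho> \<Longrightarrow> (V has_real_derivative - (r powr (- \<alpha> - 1) * G r)) (at r)"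
    "V R = \<eta> / 2 * R powr - \<alpha>"
    "\<And>r. 0 < r \<Longrightarrow> r \<le> R \<Longrightarrow> \<eta> * \<epsilon> / 8 * r powr - \<alpha> \<le> V r"
    "\<And>r. 0 < r \<Longrightarrow> r \<le> R \<Longrightarrow> V r \<le> \<eta> * r powr - \<alpha> * (\<epsilon> / 2 + (r / R) powr (\<alpha> / 2))"
proof -
  let ?W = "\<lambda>r. r powr (- \<alpha> - 1) * G r"
  \<comment> \<open>The flux blows up at 0, so the antiderivative is taken on the open interval from
    0 to \<rho>.\<close>
  have "\<exists>F. \<forall>r::real. ereal 0 < r \<longrightarrow> r < ereal \<rho> \<longrightarrow> (F has_vector_derivative - ?W r) (at r)"
    by (rule einterval_antiderivative) (use R in \<open>auto intro!: continuous_intros G_cont\<close>)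
  then obtain F where F: "\<And>r. 0 < r \<Longrightarrow> r < \<rho> \<Longrightarrow> (F has_real_derivative - ?W r) (at r)"
    by (auto simp: has_real_derivative_iff_has_vector_derivative)
  define V where "V r = F r - F R + \<eta> / 2 * R powr - \<alpha>" for r
  have V: "(V has_real_derivative - ?W r) (at r)" if "0 < r" "r < \<rho>" for r
    unfolding V_def by (auto intro!: derivative_eq_intros F that)
  have VR: "V R = \<eta> / 2 * R powr - \<alpha>" by (simp add: V_def)
  have lower: "\<eta> * \<epsilon> / 8 * r powr - \<alpha> \<le> V r" if r: "0 < r" "r \<le> R" for r
  proof -
    let ?f = "\<lambda>s. V s - \<eta> * \<epsilon> / 8 * s powr - \<alpha>"
    let ?f' = "\<lambda>s. - ?W s - \<eta> * \<epsilon> / 8 * (- \<alpha> * s powr (- \<alpha> - 1))"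
    have "?f R \<le> ?f r"
    proof (rule DERIV_le_0_imp_decreasing_on[OF r, of ?f ?f'])
      fix s assume s: "r \<le> s" "s \<le> R"
      then have s': "0 < s" "s < \<rho>" using r R by auto
      show "(?f has_real_derivative ?f' s) (at s)"
        using s' by (auto intro!: derivative_eq_intros V)
      have "?f' s = s powr (- \<alpha> - 1) * (\<alpha> / 4 * (\<eta> * \<epsilon>) / 2 - G s)" by (simp add: algebra_simps)
      then show "?f' s \<le> 0" using G_ge[OF s'] s' by (simp add: mult_le_0_iff)
    qed
    moreover have "?f R = \<eta> * R powr - \<alpha> * (1 / 2 - \<epsilon> / 8)" by (simp add: VR algebra_simps)
    moreover have "\<eta> * R powr - \<alpha> * (1 / 2 - \<epsilon> / 8) \<ge> 0" using \<eta> \<epsilon> by simp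
    ultimately show ?thesis by linarith
  qed
  have upper: "V r \<le> \<eta> * r powr - \<alpha> * (\<epsilon> / 2 + (r / R) powr (\<alpha> / 2))" if r: "0 < r" "r \<le> R" for r
  proof -
    \<comment> \<open>An exact antiderivative of minus the flux bound from \<open>G_le\<close>:
      dividing \<alpha>/4 by the exponents \<alpha> and \<alpha>/2 gives the coefficients 1/4 and
      1/2. At R it is at least \<eta>/2 R^(-\<alpha>), the value of V there.\<close>
    let ?U = "\<lambda>s. \<eta> * (\<epsilon> / 4 * s powr - \<alpha> + R powr - (\<alpha> / 2) / 2 * s powr - (\<alpha> / 2))"
    let ?U' = "\<lambda>s. \<eta> * (\<epsilon> / 4 * (- \<alpha> * s powr (- \<alpha> - 1)) + R powr - (\<alpha> / 2) / 2 * (- (\<alpha> / 2) * s powr (- (\<alpha> / 2) - 1)))"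
    have pw: "s powr (- \<alpha> - 1) * (s / R) powr (\<alpha> / 2) = R powr - (\<alpha> / 2) * s powr (- (\<alpha> / 2) - 1)"
      if "s > 0" for s
    proof -
      have "(s / R) powr (\<alpha> / 2) = s powr (\<alpha> / 2) * R powr - (\<alpha> / 2)"
        using that R by (simp add: powr_divide powr_minus_divide)
      moreover have "s powr (- \<alpha> - 1) * s powr (\<alpha> / 2) = s powr (- (\<alpha> / 2) - 1)"
        by (simp add: powr_add[symmetric])
      ultimately show ?thesis by (simp add: ac_simps)
    qed
    have diff: "V r - ?U r \<le> V R - ?U R"
    proof -
      have "?U R - V R \<le> ?U r - V r"
      proof (rule DERIV_le_0_imp_decreasing_on[OF r, of "\<lambda>s. ?U s - V s" "\<lambda>s. ?U' s + ?W s"])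
        fix s assume s: "r \<le> s" "s \<le> R"
        then have s': "0 < s" "s < \<rho>" using r R by auto
        show "((\<lambda>s. ?U s - V s) has_real_derivative ?U' s + ?W s) (at s)"
          using s' by (auto intro!: derivative_eq_intros V simp: ac_simps)
        have "?W s \<le> s powr (- \<alpha> - 1) * (\<alpha> / 4 * (\<eta> * (\<epsilon> + (s / R) powr (\<alpha> / 2))))"
          using G_le[OF s'] s' by (intro mult_left_mono) auto
        also have "\<dots> = \<eta> * (\<alpha> / 4) * (\<epsilon> * s powr (- \<alpha> - 1) + s powr (- \<alpha> - 1) * (s / R) powr (\<alpha> / 2))"
          by (simp add: algebra_simps)
        also have "\<dots> = - ?U' s"
          unfolding pw[OF s'(1)] by (simp add: algebra_simps)
        finally show "?U' s + ?W s \<le> 0" by simp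
      qed
      then show ?thesis by simp
    qed
    have "V R \<le> ?U R"
    proof -
      have "R powr - (\<alpha> / 2) * R powr - (\<alpha> / 2) = R powr - \<alpha>" by (simp add: powr_add[symmetric])
      then have "?U R = \<eta> * (\<epsilon> / 4 + 1 / 2) * R powr - \<alpha>" by (simp add: algebra_simps)
      also have "\<dots> \<ge> \<eta> * (1 / 2) * R powr - \<alpha>"
        using \<eta> \<epsilon> by (intro mult_right_mono mult_left_mono) auto
      finally show ?thesis by (simp add: VR)
    qed
    then have "V R - ?U R \<le> 0" by simp
    with diff have "V r - ?U r \<le> 0" by (rule order_trans)
    then have "V r \<le> ?U r" by simp
    also have "?U r \<le> \<eta> * r powr - \<alpha> * (\<epsilon> / 2 + (r / R) powr (\<alpha> / 2))"
    proof -
      have "r powr - \<alpha> * (r / R) powr (\<alpha> / 2) = R powr - (\<alpha> / 2) * r powr - (\<alpha> / 2)"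
      proof -
        have "r powr - \<alpha> = r powr (- \<alpha> - 1) * r" "r powr - (\<alpha> / 2) = r powr (- (\<alpha> / 2) - 1) * r"
          using r by (simp_all add: powr_diff)
        then show ?thesis using pw[OF r(1)] by (simp add: ac_simps)
      qed
      then have "\<eta> * r powr - \<alpha> * (\<epsilon> / 2 + (r / R) powr (\<alpha> / 2)) - ?U r
          = \<eta> * (\<epsilon> / 4 * r powr - \<alpha> + R powr - (\<alpha> / 2) / 2 * r powr - (\<alpha> / 2))"
        by (simp add: algebra_simps)
      also have "\<dots> \<ge> 0" using \<eta> \<epsilon> by simp
      finally show ?thesis by simp
    qed
    finally show ?thesis .
  qed
  show ?thesis by (rule that[OF V VR lower upper])
qed

text \<open>If u exceeds V at x1, then u - V has a positive maximum on a closed annulus, and the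
  boundary estimates force it into the interior. There the gradients agree and the operators are
  ordered, while \<open>hyp\<close> bounds u^q by the quantity for which V is a strict
  supersolution.\<close>

lemma decay_improvement:
  fixes u :: "'a::euclidean_space \<Rightarrow> real"
  assumes p: "p > 1" and \<alpha>: "\<alpha> > 0"
    and n: "(\<alpha> + 1) * (p - 1) = real DIM('a) - 1" "\<alpha> * q = real DIM('a)" and q: "q > p - 1"
    and a: "a > 0" and \<eta>: "\<eta> > 0"
    and small: "(2 * \<eta>) powr (q - p + 1) < a * ((p - 1) * (1 / 2) powr \<bar>p - 2\<bar> * (\<alpha> / 4) powr (p - 1))"
    and \<rho>: "\<rho> \<le> 1" and R: "0 < R" "R < \<rho>" and \<epsilon>: "0 < \<epsilon>" "\<epsilon> \<le> 1"
    and M: "\<And>r. 0 < r \<Longrightarrow> r < \<rho> \<Longrightarrow> (M has_real_derivative m r / r) (at r)"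
    and M_bounds: "\<And>r. 0 < r \<Longrightarrow> r < \<rho> \<Longrightarrow> 0 \<le> M r \<and> M r \<le> 1 / 2"
    and m: "\<And>r. 0 < r \<Longrightarrow> r < \<rho> \<Longrightarrow> 0 < m r \<and> m r \<le> \<alpha> / 2"
    and u: "\<And>x. x \<in> ball 0 1 - {0} \<Longrightarrow> (u has_derivative (\<lambda>h. g x \<bullet> h)) (at x)"
    and g: "\<And>x. x \<in> ball 0 1 - {0} \<Longrightarrow> (g has_derivative D x) (at x)"
    and u_pos: "\<And>x. x \<in> ball 0 1 - {0} \<Longrightarrow> u x > 0"
    and sub: "\<And>x. x \<noteq> 0 \<Longrightarrow> norm x < \<rho> \<Longrightarrow> g x \<noteq> 0 \<Longrightarrow>
      - pointwise_p_Laplacian p (g x) (D x) \<le> u x powr q * (m (norm x) / a)"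
    and lim: "((\<lambda>x. norm x powr \<alpha> * u x) \<longlongrightarrow> 0) (at 0)"
    and bdry: "\<And>x. norm x = R \<Longrightarrow> u x \<le> \<eta> / 2 * R powr - \<alpha>"
    and hyp: "\<And>x. x \<noteq> 0 \<Longrightarrow> norm x \<le> R \<Longrightarrow> u x \<le> \<eta> * norm x powr - \<alpha> * (\<epsilon> + (norm x / R) powr (\<alpha> / 2))"
    and x1: "x1 \<noteq> 0" "norm x1 \<le> R"
  shows "u x1 \<le> \<eta> * norm x1 powr - \<alpha> * (\<epsilon> / 2 + (norm x1 / R) powr (\<alpha> / 2))"
proof -
  \<comment> \<open>As M lies between 0 and 1/2, the weight 1/2 + M stays between 1/2 and 1: G may
    grow at the rate m while remaining within a factor 2 of its upper bound.\<close>
  define G where "G r = \<alpha> / 4 * (\<eta> * (\<epsilon> * (1 / 2 + M r) + (r / R) powr (\<alpha> / 2)))" for r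
  define G' where "G' r = \<alpha> / 4 * (\<eta> * (\<epsilon> * (m r / r) + \<alpha> / 2 * (r / R) powr (\<alpha> / 2) / r))" for r
  have G: "(G has_real_derivative G' r) (at r)" if r: "0 < r" "r < \<rho>" for r
  proof -
    have "((\<lambda>r. (r / R) powr (\<alpha> / 2)) has_real_derivative \<alpha> / 2 * (r / R) powr (\<alpha> / 2) / r) (at r)"
      using r R by (auto intro!: derivative_eq_intros simp: powr_diff)
    from DERIV_cmult[OF DERIV_cmult[OF DERIV_add[OF DERIV_cmult[OF DERIV_add[OF DERIV_const M[OF r]]] this]]]
    show ?thesis
      unfolding G_def[abs_def] G'_def by (rule DERIV_cong) simp
  qed
  have G_ge: "\<alpha> / 4 * (\<eta> * (\<epsilon> + (r / R) powr (\<alpha> / 2))) / 2 \<le> G r" if r: "0 < r" "r < \<rho>" for r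
  proof -
    have "(\<epsilon> + (r / R) powr (\<alpha> / 2)) / 2 \<le> \<epsilon> * (1 / 2 + M r) + (r / R) powr (\<alpha> / 2)"
      using \<epsilon> M_bounds[OF r] mult_nonneg_nonneg[of \<epsilon> "M r"] powr_ge_zero[of "r / R" "\<alpha> / 2"]
      by (simp add: algebra_simps add_divide_distrib del: powr_ge_zero)
    then have "\<alpha> / 4 * \<eta> * ((\<epsilon> + (r / R) powr (\<alpha> / 2)) / 2) \<le> \<alpha> / 4 * \<eta> * (\<epsilon> * (1 / 2 + M r) + (r / R) powr (\<alpha> / 2))"
      using \<alpha> \<eta> by (intro mult_left_mono) auto
    then show ?thesis by (simp add: G_def)
  qed
  have G_le: "G r \<le> \<alpha> / 4 * (\<eta> * (\<epsilon> + (r / R) powr (\<alpha> / 2)))" if r: "0 < r" "r < \<rho>" for r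
  proof -
    have "\<epsilon> * (1 / 2 + M r) \<le> \<epsilon> * 1" using \<epsilon> M_bounds[OF r] by (intro mult_left_mono) auto
    then show ?thesis unfolding G_def using \<alpha> \<eta> by (intro mult_left_mono) auto
  qed
  have G_ge': "\<alpha> / 4 * (\<eta> * \<epsilon>) / 2 \<le> G r" if r: "0 < r" "r < \<rho>" for r
  proof -
    have "\<alpha> / 4 * (\<eta> * \<epsilon>) / 2 \<le> \<alpha> / 4 * (\<eta> * (\<epsilon> + (r / R) powr (\<alpha> / 2))) / 2"
      using \<alpha> \<eta> by (intro divide_right_mono mult_left_mono) auto
    with G_ge[OF r] show ?thesis by linarith
  qed
  have Gcont: "isCont G r" if "0 < r" "r < \<rho>" for r
    using G[OF that] by (rule DERIV_isCont)
  obtain V where V: "\<And>r. 0 < r \<Longrightarrow> r < \<rho> \<Longrightarrow> (V has_real_derivative - (r powr (- \<alpha> - 1) * G r)) (at r)"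
    and VR: "V R = \<eta> / 2 * R powr - \<alpha>"
    and V_ge: "\<And>r. 0 < r \<Longrightarrow> r \<le> R \<Longrightarrow> \<eta> * \<epsilon> / 8 * r powr - \<alpha> \<le> V r"
    and V_le: "\<And>r. 0 < r \<Longrightarrow> r \<le> R \<Longrightarrow> V r \<le> \<eta> * r powr - \<alpha> * (\<epsilon> / 2 + (r / R) powr (\<alpha> / 2))"
    using radial_barrier_exists[OF \<alpha> \<eta> \<epsilon> R Gcont G_ge' G_le] by blast
  have "u x1 \<le> V (norm x1)"
  proof (rule ccontr)
    assume contra: "\<not> u x1 \<le> V (norm x1)"
    have "\<eta> * \<epsilon> / 8 > 0" using \<eta> \<epsilon> by simp
    from order_tendstoD(2)[OF lim this]
    obtain d where d: "d > 0" "\<And>x. x \<noteq> 0 \<Longrightarrow> norm x < d \<Longrightarrow> norm x powr \<alpha> * u x < \<eta> * \<epsilon> / 8"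
      by (auto simp: eventually_at)
    \<comment> \<open>The inner radius depends on \<epsilon>: it is small enough that u lies below
      \<eta> \<epsilon>/8 r^(-\<alpha>), a lower bound for V, and at most |x1| so that the annulus
      contains x1.\<close>
    define r0 where "r0 = min (d / 2) (norm x1)"
    have r0: "0 < r0" "r0 < d" "r0 \<le> norm x1" using d x1 by (auto simp: r0_def min_less_iff_disj)
    have inner: "u x < V (norm x)" if "norm x = r0" for x
    proof -
      have x: "x \<noteq> 0" "norm x < d" "norm x \<le> R" using that r0 x1 by auto
      have "u x = norm x powr - \<alpha> * (norm x powr \<alpha> * u x)"
        using x by (simp add: powr_minus)
      also have "\<dots> < norm x powr - \<alpha> * (\<eta> * \<epsilon> / 8)"
        using d(2)[OF x(1,2)] x by (intro mult_strict_left_mono) auto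
      also have "\<dots> \<le> V (norm x)" using V_ge[of "norm x"] x by (simp add: mult.commute)
      finally show ?thesis .
    qed
    define v where "v x = V (norm x)" for x :: 'a
    define W where "W r = r powr (- \<alpha> - 1) * G r" for r
    define gv where "gv x = - (W (norm x) / norm x) *\<^sub>R x" for x :: 'a
    have v: "(v has_derivative (\<lambda>h. gv x \<bullet> h)) (at x)" if "x \<noteq> 0" "norm x < \<rho>" for x
      unfolding v_def gv_def by (rule radial_gradient) (use V that in \<open>auto simp: W_def\<close>)
    define C where "C = cball (0::'a) R - ball 0 r0"
    have C: "x \<in> C \<longleftrightarrow> r0 \<le> norm x \<and> norm x \<le> R" for x by (auto simp: C_def)
    have C': "x \<noteq> 0" "norm x < \<rho>" "x \<in> ball 0 1 - {0}" if "x \<in> C" for x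
      using that r0 R \<rho> by (auto simp: C)
    have "compact C" unfolding C_def by (intro compact_diff) auto
    moreover have "continuous_on C (\<lambda>x. u x - v x)"
    proof (intro continuous_on_diff continuous_at_imp_continuous_on ballI)
      show "isCont u x" if "x \<in> C" for x using u[OF C'(3)[OF that]] has_derivative_continuous by blast
      show "isCont v x" if "x \<in> C" for x using v[OF C'(1,2)[OF that]] has_derivative_continuous by blast
    qed
    moreover have "x1 \<in> C" using x1 r0 by (simp add: C)
    ultimately obtain x0 where x0: "x0 \<in> C" "\<And>y. y \<in> C \<Longrightarrow> u y - v y \<le> u x0 - v x0"
      using continuous_attains_sup[of C "\<lambda>x. u x - v x"] by blast
    have pos: "u x0 - v x0 > 0" using x0(2)[OF \<open>x1 \<in> C\<close>] contra by (simp add: v_def)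
    have "norm x0 \<noteq> r0" using inner[of x0] pos by (auto simp: v_def)
    moreover have "norm x0 \<noteq> R" using bdry[of x0] VR pos by (auto simp: v_def)
    ultimately have x0T: "x0 \<in> ball 0 R - cball 0 r0" using x0(1) by (auto simp: C)
    define r where "r = norm x0"
    have r: "0 < r" "r < R" "r < \<rho>" using x0T r0 R by (auto simp: r_def)
    have x0': "x0 \<noteq> 0" "norm x0 < \<rho>" "x0 \<in> ball 0 1 - {0}" using C' x0(1) by auto
    define w where "w = r powr (- \<alpha> - 1) * G' r + (- \<alpha> - 1) * r powr (- \<alpha> - 1 - 1) * G r"
    have Wd: "(W has_real_derivative w) (at (norm x0))"
      unfolding W_def[abs_def] w_def r_def[symmetric]
      using r by (auto intro!: derivative_eq_intros G)
    have Gpos: "G r > 0"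
    proof -
      have "\<alpha> / 4 * (\<eta> * \<epsilon>) / 2 > 0" using \<alpha> \<eta> \<epsilon> by simp
      with G_ge'[OF r(1,3)] show ?thesis by linarith
    qed
    have Wpos: "W r > 0" using r Gpos by (simp add: W_def)
    then have Wnz: "W (norm x0) \<noteq> 0" by (simp add: r_def)
    note hess = radial_hessian[OF x0'(1) Wd Wnz]
    have gvnz: "gv x0 \<noteq> 0" using Wnz x0'(1) by (simp add: gv_def)
    have inT: "y \<in> C" if "y \<in> ball 0 R - cball 0 r0" for y using that by (auto simp: C)
    have op: "open (ball 0 R - cball (0::'a) r0)" by (intro open_Diff) auto
    note cmp = p_Laplacian_le_at_max[OF op x0T p u[OF C'(3)[OF inT]] v[OF C'(1,2)[OF inT]] g[OF x0'(3)]
        hess(1)[folded gv_def] gvnz x0(2)[OF inT]]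
    have "g x0 \<noteq> 0" using cmp(1) gvnz by simp
    have "W r powr (p - 2) * ((p - 1) * w + (real DIM('a) - 1) * W r / r) \<le> u x0 powr q * (m r / a)"
    proof -
      have "pointwise_p_Laplacian p (g x0) (D x0)
          \<le> - (W r powr (p - 2) * ((p - 1) * w + (real DIM('a) - 1) * W r / r))"
        using cmp(2)[unfolded gv_def hess(2)] Wpos by (simp add: r_def)
      with sub[OF x0'(1,2) \<open>g x0 \<noteq> 0\<close>] show ?thesis by (simp add: r_def)
    qed
    \<comment> \<open>Since (\<alpha> + 1)(p - 1) = n - 1, the derivative of r^(-\<alpha>-1) cancels
      the curvature term (n-1) W/r and only G' survives.\<close>
    also have "(p - 1) * w + (real DIM('a) - 1) * W r / r = (p - 1) * (r powr (- \<alpha> - 1) * G' r)"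
    proof -
      have "r powr (- \<alpha> - 1 - 1) = r powr (- \<alpha> - 1) / r"
        using r powr_diff[of r "- \<alpha> - 1" 1] by simp
      then have "w = r powr (- \<alpha> - 1) * G' r - (\<alpha> + 1) * W r / r"
        using r unfolding w_def W_def by (simp only:) (simp add: field_simps)
      then show ?thesis
        unfolding n(1)[symmetric] by (simp add: right_diff_distrib ac_simps)
    qed
    also have "u x0 powr q \<le> (\<eta> * r powr - \<alpha> * (\<epsilon> + (r / R) powr (\<alpha> / 2))) powr q"
      using hyp[OF x0'(1)] r u_pos[OF x0'(3)] q p by (intro powr_mono2) (auto simp: r_def)
    also have "(\<eta> * r powr - \<alpha> * (\<epsilon> + (r / R) powr (\<alpha> / 2))) powr q * (m r / a)
        < (r powr (- \<alpha> - 1) * G r) powr (p - 2) * ((p - 1) * (r powr (- \<alpha> - 1) * G' r))"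
    proof (rule barrier_flux_strict[OF p \<alpha> n q a \<eta> small r(1) _ _ _ refl G_ge[OF r(1,3)] G_le[OF r(1,3)]])
      show "m r > 0" using m r by blast
      show "0 < \<epsilon> + (r / R) powr (\<alpha> / 2)" using \<epsilon> by (simp add: add_pos_nonneg)
      have "(r / R) powr (\<alpha> / 2) \<le> 1 powr (\<alpha> / 2)" using r R \<alpha> by (intro powr_mono2) auto
      then show "\<epsilon> + (r / R) powr (\<alpha> / 2) \<le> 2" using \<epsilon> by simp
      \<comment> \<open>The summand \<epsilon> m in r G' matches its counterpart exactly; the
        summand with (r/R)^(\<alpha>/2) is handled by m \<le> \<alpha>/2.\<close>
      have "m r * (r / R) powr (\<alpha> / 2) \<le> \<alpha> / 2 * (r / R) powr (\<alpha> / 2)"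
        using m[OF r(1,3)] by (intro mult_right_mono) auto
      then have "\<alpha> / 4 * \<eta> * ((\<epsilon> + (r / R) powr (\<alpha> / 2)) * m r) \<le> \<alpha> / 4 * \<eta> * (\<epsilon> * m r + \<alpha> / 2 * (r / R) powr (\<alpha> / 2))"
        using \<alpha> \<eta> by (intro mult_left_mono) (auto simp: algebra_simps)
      moreover have "r * G' r = \<alpha> / 4 * \<eta> * (\<epsilon> * m r + \<alpha> / 2 * (r / R) powr (\<alpha> / 2))"
        using r by (simp add: G'_def distrib_left)
      ultimately show "\<alpha> / 4 * (\<eta> * (\<epsilon> + (r / R) powr (\<alpha> / 2))) * m r \<le> r * G' r"
        by (simp only: mult.assoc)
    qed
    finally show False using m[OF r(1,3)] a by (simp add: W_def divide_right_mono)
  qed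
  also have "\<dots> \<le> \<eta> * norm x1 powr - \<alpha> * (\<epsilon> / 2 + (norm x1 / R) powr (\<alpha> / 2))"
    using V_le x1 by simp
  finally show ?thesis .
qed

subsection \<open>Blow-up rate and conclusion\<close>

lemma filterlim_norm_at_0: "filterlim (norm :: 'a::real_normed_vector \<Rightarrow> real) (at_right 0) (at 0)"
  by (auto simp: filterlim_at eventually_at_filter intro!: tendsto_norm_zero tendsto_ident_at)

text \<open>A positive lower limit gives u at least a multiple of r^(-\<alpha>) times a power of the
  logarithm, and any power of the logarithm is negligible against r^(-\<alpha>/2). The constant C/2
  makes the inequality for the lower limit strict.\<close>

lemma Liminf_imp_power_blowup:
  fixes u :: "'a::euclidean_space \<Rightarrow> real"
  assumes \<alpha>: "\<alpha> > 0" and C: "C > 0"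
    and L: "Liminf (at 0) (\<lambda>x. ereal (ln (1 / norm x) powr \<gamma> * norm x powr \<alpha> * u x)) \<ge> ereal C"
  shows "filterlim (\<lambda>x. norm x powr (\<alpha> / 2) * u x) at_top (at 0)"
proof -
  have lim: "filterlim (\<lambda>r::real. C / 2 * (r powr - (\<alpha> / 2) * ln (1 / r) powr - \<gamma>)) at_top (at_right 0)"
    using \<alpha> C by real_asymp
  have small: "\<forall>\<^sub>F x::'a in at 0. norm x < 1"
    by (auto simp: eventually_at intro!: exI[of _ 1])
  have nz: "\<forall>\<^sub>F x::'a in at 0. x \<noteq> 0" by (simp add: eventually_at_filter)
  have "ereal (C / 2) < Liminf (at 0) (\<lambda>x. ereal (ln (1 / norm x) powr \<gamma> * norm x powr \<alpha> * u x))"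
    by (rule less_le_trans[OF _ L]) (use C in simp)
  then have "\<forall>\<^sub>F x in at 0. ereal (C / 2) < ereal (ln (1 / norm x) powr \<gamma> * norm x powr \<alpha> * u x)"
    by (rule less_LiminfD)
  with small nz have "\<forall>\<^sub>F x in at 0. C / 2 * (norm x powr - (\<alpha> / 2) * ln (1 / norm x) powr - \<gamma>)
      \<le> norm x powr (\<alpha> / 2) * u x"
  proof eventually_elim
    case (elim x)
    define l where "l = ln (1 / norm x)"
    have r: "norm x > 0" and l: "l > 0" using elim by (simp_all add: l_def)
    have "C / 2 * (norm x powr - (\<alpha> / 2) * l powr - \<gamma>)
        \<le> (l powr \<gamma> * norm x powr \<alpha> * u x) * (norm x powr - (\<alpha> / 2) * l powr - \<gamma>)"
      using elim by (intro mult_right_mono) (auto simp: l_def)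
    also have "\<dots> = (l powr \<gamma> * l powr - \<gamma>) * ((norm x powr \<alpha> * norm x powr - (\<alpha> / 2)) * u x)" by simp
    also have "l powr \<gamma> * l powr - \<gamma> = 1" using l by (simp add: powr_minus)
    also have "norm x powr \<alpha> * norm x powr - (\<alpha> / 2) = norm x powr (\<alpha> / 2)"
      by (simp add: powr_add[symmetric])
    finally show ?case by (simp add: l_def)
  qed
  then show ?thesis
    by (rule filterlim_at_top_mono[OF filterlim_compose[OF lim filterlim_norm_at_0]])
qed

lemma continuous_on_iter_log:
  fixes u :: "'a::topological_space \<Rightarrow> real"
  assumes u: "continuous_on S u" and pos: "\<And>x i. x \<in> S \<Longrightarrow> i < j \<Longrightarrow> iter_log i (u x) > 0"
  shows "continuous_on S (\<lambda>x. iter_log j (u x))"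
  using pos
proof (induction j)
  case 0
  then show ?case using u by simp
next
  case (Suc j)
  then have "continuous_on S (\<lambda>x. iter_log j (u x))" by simp
  then show ?case using Suc.prems[of _ j] by (auto intro!: continuous_on_ln simp: less_imp_neq[symmetric])
qed

theorem theorem1p3:
  fixes u :: "real ^ 'n \<Rightarrow> real" and n :: nat and p \<beta> :: real and Q :: nat
  assumes n_def: "n = CARD('n)" and n_ge: "n \<ge> 2"
    and p: "1 < p" "p < real n"
    and Q: "Q \<ge> 1"
    and beta: "\<beta> > 1"
    and C2: "Ck_on 2 u (ball 0 1 - {0})"
    and u_pos: "\<And>x. x \<in> ball 0 1 - {0} \<Longrightarrow> u x > 0"
    and log_pos: "\<And>x j. x \<in> ball 0 1 - {0} \<Longrightarrow> j \<in> {1..Q} \<Longrightarrow> iter_log j (u x) > 0"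
    and lower: "neg_p_Laplacian_ge p (ball 0 1 - {0}) u (\<lambda>x. 0)"
    and upper: "neg_p_Laplacian_le p (ball 0 1 - {0}) u
      (\<lambda>x. u x powr (real n * (p - 1) / (real n - p)) /
            ((\<Prod>j\<in>{1..<Q}. iter_log j (u x)) * iter_log Q (u x) powr \<beta>))"
  shows "\<not> (((\<lambda>x. norm x powr ((real n - p) / (p - 1)) * u x) \<longlongrightarrow> 0) (at 0) \<and>
    Liminf (at 0) (\<lambda>x. ereal (ln (1 / norm x) powr ((real n - p) / (p * (p - 1))) *
                               norm x powr ((real n - p) / (p - 1)) * u x))
      \<ge> ereal ((((real n - p) / p) * ((real n - p) / (p - 1)) powr (p - 1))
               powr ((real n - p) / (p * (p - 1)))))"
proof
  define \<alpha> where "\<alpha> = (real n - p) / (p - 1)"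
  define q where "q = real n * (p - 1) / (real n - p)"
  define a where "a = \<alpha> / 2"
  let ?S = "ball 0 1 - {0} :: (real ^ 'n) set"
  assume asm: "((\<lambda>x. norm x powr ((real n - p) / (p - 1)) * u x) \<longlongrightarrow> 0) (at 0) \<and>
    Liminf (at 0) (\<lambda>x. ereal (ln (1 / norm x) powr ((real n - p) / (p * (p - 1))) *
                               norm x powr ((real n - p) / (p - 1)) * u x))
      \<ge> ereal ((((real n - p) / p) * ((real n - p) / (p - 1)) powr (p - 1))
               powr ((real n - p) / (p * (p - 1))))"
  have lim: "((\<lambda>x. norm x powr \<alpha> * u x) \<longlongrightarrow> 0) (at 0)"
    using asm by (simp add: \<alpha>_def)
  have \<alpha>: "\<alpha> > 0" and a: "a > 0" using p by (simp_all add: \<alpha>_def a_def)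
  have dim: "(\<alpha> + 1) * (p - 1) = real DIM(real ^ 'n) - 1" "\<alpha> * q = real DIM(real ^ 'n)"
  proof -
    have "p - 1 \<noteq> 0" "real n - p \<noteq> 0" using p by simp_all
    then have "\<alpha> * (p - 1) = real n - p" "\<alpha> * q = real n" by (simp_all add: \<alpha>_def q_def)
    then show "(\<alpha> + 1) * (p - 1) = real DIM(real ^ 'n) - 1" "\<alpha> * q = real DIM(real ^ 'n)"
      by (simp_all add: n_def distrib_right)
  qed
  have q: "q > p - 1"
  proof -
    have "(p - 1) * (real n - p) < (p - 1) * real n" using p by (intro mult_strict_left_mono) auto
    then show ?thesis using p by (simp add: q_def field_simps)
  qed
  have blowup: "filterlim (\<lambda>x. norm x powr a * u x) at_top (at 0)"
    unfolding a_def
    by (rule Liminf_imp_power_blowup[OF \<alpha> _ asm[THEN conjunct2, folded \<alpha>_def]]) (use p \<alpha> in simp)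
  obtain g D where u: "\<And>x. x \<in> ?S \<Longrightarrow> (u has_derivative (\<lambda>h. g x \<bullet> h)) (at x)"
    and g: "\<And>x. x \<in> ?S \<Longrightarrow> (g has_derivative D x) (at x)"
    and D: "\<And>w. continuous_on ?S w \<Longrightarrow> continuous_on ?S (\<lambda>x. D x (w x))"
    using Ck_on_2_gradient_field[OF C2] by blast
  have u_cont: "continuous_on ?S u"
    using u by (intro continuous_at_imp_continuous_on ballI has_derivative_continuous)
  have iter_pos: "iter_log j (u x) > 0" if "x \<in> ?S" "j \<le> Q" for x j
    using u_pos[OF that(1)] log_pos[OF that(1), of j] that(2) by (cases j) auto
  have "continuous_on ?S (\<lambda>x. u x powr q / log_product Q \<beta> (u x))"
  proof -
    have "continuous_on ?S (\<lambda>x. iter_log j (u x))" if "j \<le> Q" for j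
      by (rule continuous_on_iter_log[OF u_cont]) (use that iter_pos in auto)
    moreover have "log_product Q \<beta> (u x) \<noteq> 0" if "x \<in> ?S" for x
      using log_product_pos[OF Q, of "u x" \<beta>] log_pos[OF that] by simp
    ultimately show ?thesis
      using iter_pos u_pos unfolding log_product_def
      by (intro continuous_intros u_cont) (auto simp: less_imp_neq[symmetric] order_less_imp_not_eq2)
  qed
  note pointwise = weak_le_imp_pointwise_le[OF _ u g D this]
  have upper': "- pointwise_p_Laplacian p (g x) (D x) \<le> u x powr q / log_product Q \<beta> (u x)"
    if "x \<in> ?S" "g x \<noteq> 0" for x
    by (rule pointwise) (use upper that in \<open>auto simp: log_product_def q_def open_Diff\<close>)
  obtain M \<rho>1 where \<rho>1: "\<rho>1 > 0" "\<rho>1 < 1"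
    and log_r: "\<And>r j. 0 < r \<Longrightarrow> r < \<rho>1 \<Longrightarrow> j \<le> Q \<Longrightarrow> iter_log j (r powr - a) > 0"
    and M: "\<And>r. 0 < r \<Longrightarrow> r < \<rho>1 \<Longrightarrow> (M has_real_derivative a / log_product Q \<beta> (r powr - a) / r) (at r)"
    and M_bounds: "\<And>r. 0 < r \<Longrightarrow> r < \<rho>1 \<Longrightarrow> 0 \<le> M r \<and> M r \<le> 1 / 2"
    and m_le: "\<And>r. 0 < r \<Longrightarrow> r < \<rho>1 \<Longrightarrow> a / log_product Q \<beta> (r powr - a) \<le> \<alpha> / 2"
    by (rule dini_weight_exists[OF Q beta a half_gt_zero[OF \<alpha>]]) (rule that; assumption)
  \<comment> \<open>The factor a stems from differentiating r^(-a), so the plain reciprocal of the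
    log product is m/a; this explains the division by a in \<open>sub\<close>.\<close>
  define m where "m r = a / log_product Q \<beta> (r powr - a)" for r
  have prod_r: "log_product Q \<beta> (r powr - a) > 0" if "0 < r" "r < \<rho>1" for r
    by (rule log_product_pos[OF Q]) (use log_r that in auto)
  define K where "K = a * ((p - 1) * (1 / 2) powr \<bar>p - 2\<bar> * (\<alpha> / 4) powr (p - 1))"
  have K: "K > 0" using a p \<alpha> by (simp add: K_def)
  \<comment> \<open>Chosen so that (2\<eta>)^(q-p+1) = K/2, which is strictly below K.\<close>
  define \<eta> where "\<eta> = (K / 2) powr (1 / (q - p + 1)) / 2"
  have \<eta>: "\<eta> > 0" using K by (simp add: \<eta>_def)
  have small: "(2 * \<eta>) powr (q - p + 1) < K"
    using K q by (simp add: \<eta>_def powr_powr)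
  have "\<forall>\<^sub>F x in at 0. norm x powr a * u x \<ge> 1"
    using blowup by (simp add: filterlim_at_top)
  then obtain \<rho>2 where \<rho>2: "\<rho>2 > 0" "\<And>x. x \<noteq> 0 \<Longrightarrow> norm x < \<rho>2 \<Longrightarrow> norm x powr a * u x \<ge> 1"
    by (auto simp: eventually_at)
  define \<rho> where "\<rho> = min \<rho>1 \<rho>2"
  have \<rho>: "\<rho> > 0" "\<rho> \<le> 1" "\<rho> \<le> \<rho>1" "\<rho> \<le> \<rho>2" using \<rho>1 \<rho>2 by (auto simp: \<rho>_def)
  have "\<forall>\<^sub>F x in at 0. norm x powr \<alpha> * u x < \<eta> / 2"
    by (rule order_tendstoD(2)[OF lim]) (use \<eta> in simp)
  then obtain \<rho>3 where \<rho>3: "\<rho>3 > 0" "\<And>x. x \<noteq> 0 \<Longrightarrow> norm x < \<rho>3 \<Longrightarrow> norm x powr \<alpha> * u x < \<eta> / 2"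
    by (auto simp: eventually_at)
  define R where "R = min \<rho> \<rho>3 / 2"
  have R: "0 < R" "R < \<rho>" "R < \<rho>3" using \<rho> \<rho>3 by (auto simp: R_def)
  have inS: "x \<in> ?S" if "x \<noteq> 0" "norm x < \<rho>" for x using that \<rho> by simp
  have start: "u x \<le> \<eta> / 2 * norm x powr - \<alpha>" if "x \<noteq> 0" "norm x \<le> R" for x
  proof -
    have "norm x powr \<alpha> * u x < \<eta> / 2" using \<rho>3(2)[of x] that R by simp
    then show ?thesis using that by (simp add: powr_minus field_simps)
  qed
  have sub: "- pointwise_p_Laplacian p (g x) (D x) \<le> u x powr q * (m (norm x) / a)"
    if x: "x \<noteq> 0" "norm x < \<rho>" "g x \<noteq> 0" for x
  proof -
    let ?y = "norm x powr - a"
    have r: "0 < norm x" "norm x < \<rho>1" using x \<rho> by auto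
    have "1 \<le> norm x powr a * u x" using \<rho>2(2) x \<rho> by simp
    \<comment> \<open>The log product increases with its argument, so replacing u by the smaller
      r^(-a) turns the denominator into a radial function and enlarges the quotient.\<close>
    then have "?y \<le> u x" using x by (simp add: powr_minus field_simps)
    then have "log_product Q \<beta> ?y \<le> log_product Q \<beta> (u x)"
      using log_r[OF r] beta by (intro log_product_mono) auto
    then have "u x powr q / log_product Q \<beta> (u x) \<le> u x powr q / log_product Q \<beta> ?y"
      using prod_r[OF r] by (intro divide_left_mono) auto
    with upper'[OF inS[OF x(1,2)] x(3)] show ?thesis using a by (simp add: m_def)
  qed
  have iterate: "u x \<le> \<eta> * norm x powr - \<alpha> * ((1 / 2) ^ k + (norm x / R) powr (\<alpha> / 2))"
    if "x \<noteq> 0" "norm x \<le> R" for x k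
    using that
  proof (induction k arbitrary: x)
    case 0
    \<comment> \<open>The start is \<epsilon> = 1, where the bound \<eta>/2 r^(-\<alpha>) coming
      from u = o(r^(-\<alpha>)) is more than enough.\<close>
    have "u x \<le> \<eta> * norm x powr - \<alpha> * (1 / 2)" using start[OF 0] by simp
    also have "\<dots> \<le> \<eta> * norm x powr - \<alpha> * ((1 / 2) ^ 0 + (norm x / R) powr (\<alpha> / 2))"
      using \<eta> by (intro mult_left_mono) (auto simp: add_increasing2)
    finally show ?case .
  next
    case (Suc k)
    have "u x \<le> \<eta> * norm x powr - \<alpha> * ((1 / 2) ^ k / 2 + (norm x / R) powr (\<alpha> / 2))"
    proof (rule decay_improvement[OF p(1) \<alpha> dim q a \<eta> small[unfolded K_def] \<rho>(2) R(1,2)])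
      show "(M has_real_derivative m r / r) (at r)" if "0 < r" "r < \<rho>" for r
        using M[of r] that \<rho> by (simp add: m_def)
      show "0 \<le> M r \<and> M r \<le> 1 / 2" if "0 < r" "r < \<rho>" for r
        using M_bounds[of r] that \<rho> by simp
      show "0 < m r \<and> m r \<le> \<alpha> / 2" if "0 < r" "r < \<rho>" for r
        using m_le[of r] prod_r[of r] a that \<rho> by (simp add: m_def)
      show "u x \<le> \<eta> / 2 * R powr - \<alpha>" if "norm x = R" for x
        using start[of x] that R by auto
    qed (use u g u_pos sub lim Suc in \<open>auto simp: power_le_one\<close>)
    then show ?case by simp
  qed
  have bound: "u x \<le> \<eta> * norm x powr - \<alpha> * (norm x / R) powr (\<alpha> / 2)" if "x \<noteq> 0" "norm x \<le> R" for x
  \<comment> \<open>With R and \<eta> fixed, k tends to infinity at each point x separately and the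
    singular part \<epsilon> r^(-\<alpha>) disappears.\<close>
  proof (rule LIMSEQ_le_const)
    have "(\<lambda>k. \<eta> * norm x powr - \<alpha> * ((1 / 2) ^ k + (norm x / R) powr (\<alpha> / 2)))
        \<longlonglongrightarrow> \<eta> * norm x powr - \<alpha> * (0 + (norm x / R) powr (\<alpha> / 2))"
      by (intro tendsto_intros LIMSEQ_realpow_zero) auto
    then show "(\<lambda>k. \<eta> * norm x powr - \<alpha> * ((1 / 2) ^ k + (norm x / R) powr (\<alpha> / 2)))
        \<longlonglongrightarrow> \<eta> * norm x powr - \<alpha> * (norm x / R) powr (\<alpha> / 2)" by simp
  qed (use iterate[OF that] in blast)
  define B where "B = \<eta> * R powr - a"
  have B: "norm x powr a * u x \<le> B" if "x \<noteq> 0" "norm x \<le> R" for x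
  proof -
    have "norm x powr a * u x \<le> norm x powr a * (\<eta> * norm x powr - \<alpha> * (norm x / R) powr a)"
      using bound[OF that] by (intro mult_left_mono) (auto simp: a_def)
    also have "(norm x / R) powr a = norm x powr a * R powr - a"
      using R by (simp add: powr_divide powr_minus_divide)
    also have "norm x powr a * (\<eta> * norm x powr - \<alpha> * (norm x powr a * R powr - a))
        = (norm x powr a * norm x powr a * norm x powr - \<alpha>) * B"
      by (simp add: B_def ac_simps)
    \<comment> \<open>The exponents cancel because 2a = \<alpha>; hence r^a u stays below the
      constant B, against \<open>blowup\<close>.\<close>
    also have "norm x powr a * norm x powr a * norm x powr - \<alpha> = 1"
      using that by (simp add: powr_add[symmetric] a_def)
    finally show ?thesis by simp
  qed
  have "\<forall>\<^sub>F x in at 0. norm x powr a * u x \<ge> B + 1"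
    using blowup by (simp add: filterlim_at_top)
  moreover have "\<forall>\<^sub>F x::real^'n in at 0. norm x < R"
    using R by (auto simp: eventually_at intro!: exI[of _ R])
  moreover have "\<forall>\<^sub>F x::real^'n in at 0. x \<noteq> 0" by (simp add: eventually_at_filter)
  ultimately have "\<forall>\<^sub>F x::real^'n in at 0. False"
    by eventually_elim (use B in force)
  then show False by simp
qed

end
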